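(* Let $X=\partial_x$ and $Y=x\,\partial_y$ be the Grushin vector fields on $\mathbb R^2$, with $Z=[X,Y]=\partial_y$. Let $\tilde H\in C^2(\mathbb R^m)$ satisfy $\tilde H(\alpha)=\tilde H(\beta)=0\le\tilde H(\cdot)$ for some $\alpha=(\alpha_i)_{i=1}^m$ and $\beta=(\beta_i)_{i=1}^m$ in $\mathbb R^m$. Suppose that $u=(u_i)_{i=1}^m\in C^2(\mathbb R^2,\mathbb R^m)$ is a local minimum of the energy $$E(u,\Omega)=\int_\Omega\left[\frac12\sum_{i=1}^m|\nabla_{\mathbb G}u_i|^2+\tilde H(u)\right]dx\,dy$$ with $\Omega=\mathbb R^2$. Assume that, for each $i$, $\alpha_i\le u_i\le\beta_i$, $|\nabla_{\mathbb G}u_i|\in L^\infty(\mathbb R^2)$, $|\nabla_{\mathbb G}u_i|\ne0$ everywhere, and $$ZYu_i\,Xu_i-ZXu_i\,Yu_i\le0 .$$ Then each $u_i$ depends only on the variable $x$.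
   Context: $\nabla_{\mathbb G}v:=(Xv)X+(Yv)Y$, $|\nabla_{\mathbb G}v|=\sqrt{(Xv)^2+(Yv)^2}=\sqrt{(\partial_xv)^2+x^2(\partial_yv)^2}$. Local minimum: $u\in C^2(\Omega,\mathbb R^m)$ is a local minimum of $E$ if $E(u,\Pi)\le E(v,\Pi)$ for every bounded open subset $\Pi\subset\Omega$ and every $v=(v_i)_{i=1}^m$ with $v=u$ in $\Omega\setminus\Pi$ (competitors $v$ being locally Lipschitz, so that the energy is defined). *)

theory Defs
  imports "HOL-Analysis.Analysis"
begin

text \<open>
  Classes \<open>C\<^sup>1\<close> and \<open>C\<^sup>2\<close> in the Frechet sense; the definitions are meant for open \<open>S\<close>.
\<close>

definition C1_on :: "'a::real_normed_vector set \<Rightarrow> ('a \<Rightarrow> 'b::real_normed_vector) \<Rightarrow> bool" where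
  "C1_on S f \<longleftrightarrow> (\<exists>f' :: 'a \<Rightarrow> 'a \<Rightarrow>\<^sub>L 'b.
     (\<forall>p\<in>S. (f has_derivative blinfun_apply (f' p)) (at p)) \<and> continuous_on S f')"

definition C2_on :: "'a::real_normed_vector set \<Rightarrow> ('a \<Rightarrow> 'b::real_normed_vector) \<Rightarrow> bool" where
  "C2_on S f \<longleftrightarrow> (\<exists>f' :: 'a \<Rightarrow> 'a \<Rightarrow>\<^sub>L 'b.
     (\<forall>p\<in>S. (f has_derivative blinfun_apply (f' p)) (at p)) \<and> C1_on S f')"

definition locally_lipschitz_on :: "'a::metric_space set \<Rightarrow> ('a \<Rightarrow> 'b::metric_space) \<Rightarrow> bool" where
  "locally_lipschitz_on S f \<longleftrightarrow> (\<forall>p\<in>S. \<exists>e>0. \<exists>L. L-lipschitz_on (ball p e \<inter> S) f)"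

definition partial_x :: "(real \<times> real \<Rightarrow> real) \<Rightarrow> real \<times> real \<Rightarrow> real" where
  "partial_x f p = deriv (\<lambda>t. f (t, snd p)) (fst p)"

definition partial_y :: "(real \<times> real \<Rightarrow> real) \<Rightarrow> real \<times> real \<Rightarrow> real" where
  "partial_y f p = deriv (\<lambda>t. f (fst p, t)) (snd p)"

definition grushin_X :: "(real \<times> real \<Rightarrow> real) \<Rightarrow> real \<times> real \<Rightarrow> real" where
  "grushin_X f p = partial_x f p"

definition grushin_Y :: "(real \<times> real \<Rightarrow> real) \<Rightarrow> real \<times> real \<Rightarrow> real" where
  "grushin_Y f p = fst p * partial_y f p"

text \<open>
  The commutator \<open>Z = [X, Y]\<close> is the vector field \<open>\<partial>\<^sub>y\<close>. It is defined directly as a first-order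
  operator, not as \<open>X (Y f) - Y (X f)\<close>, because it is applied to functions (first derivatives of
  \<open>u\<^sub>i\<close>) that are only \<open>C\<^sup>1\<close>.
\<close>

definition grushin_Z :: "(real \<times> real \<Rightarrow> real) \<Rightarrow> real \<times> real \<Rightarrow> real" where
  "grushin_Z f p = partial_y f p"

definition grushin_grad_norm :: "(real \<times> real \<Rightarrow> real) \<Rightarrow> real \<times> real \<Rightarrow> real" where
  "grushin_grad_norm f p = sqrt ((grushin_X f p)\<^sup>2 + (grushin_Y f p)\<^sup>2)"

definition L_infinity :: "(real \<times> real \<Rightarrow> real) \<Rightarrow> bool" where
  "L_infinity f \<longleftrightarrow> f \<in> borel_measurable lebesgue \<and> (\<exists>C. AE p in lebesgue. \<bar>f p\<bar> \<le> C)"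

text \<open>
  The energy takes values in \<open>[0, \<infinity>]\<close>; the definition is meant for potentials \<open>H \<ge> 0\<close>
  (\<open>ennreal\<close> sends negative reals to \<open>0\<close>). For locally Lipschitz \<open>v\<close> the partial
  derivatives exist almost everywhere, and the values of \<open>deriv\<close> elsewhere do not affect it.
\<close>

definition grushin_energy ::
    "(real^'m::finite \<Rightarrow> real) \<Rightarrow> (real \<times> real \<Rightarrow> real^'m) \<Rightarrow> (real \<times> real) set \<Rightarrow> ennreal" where
  "grushin_energy H v \<Omega> =
     (\<integral>\<^sup>+p\<in>\<Omega>. ennreal (1/2 * (\<Sum>i\<in>UNIV. (grushin_grad_norm (\<lambda>q. v q $ i) p)\<^sup>2) + H (v p)) \<partial>lebesgue)"

definition local_minimum ::
    "(real^'m::finite \<Rightarrow> real) \<Rightarrow> (real \<times> real) set \<Rightarrow> (real \<times> real \<Rightarrow> real^'m) \<Rightarrow> bool" where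
  "local_minimum H \<Omega> u \<longleftrightarrow> C2_on \<Omega> u \<and>
     (\<forall>D v. open D \<and> bounded D \<and> D \<subseteq> \<Omega> \<and> locally_lipschitz_on \<Omega> v \<and> (\<forall>p\<in>\<Omega> - D. v p = u p)
        \<longrightarrow> grushin_energy H u D \<le> grushin_energy H v D)"

end

theory Submission
  imports Defs
begin

text \<open>
  Testing the second variation of the energy with the vector fields \<open>\<eta> X u\<close> and \<open>\<eta> Y u\<close> (rather than
  with \<open>\<eta> |\<nabla>\<^sub>G u\<^sub>i|\<close>) makes the Hessian of the potential cancel against the equations satisfied by
  \<open>X u\<close> and \<open>Y u\<close>, whatever its signs, and leaves
  \<open>- 2 \<integral> \<eta>\<^sup>2 \<Sum>\<^sub>i (ZYu\<^sub>i Xu\<^sub>i - ZXu\<^sub>i Yu\<^sub>i) \<le> \<integral> |\<nabla>\<^sub>G \<eta>|\<^sup>2 \<Sum>\<^sub>i |\<nabla>\<^sub>G u\<^sub>i|\<^sup>2\<close>.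
  Comparison with a competitor equal to \<open>\<alpha>\<close> on \<open>|x| \<le> R, |y| \<le> R\<^sup>2\<close> bounds the energy there by
  \<open>C R\<^sup>2\<close>, so a logarithmic cutoff \<open>\<eta>\<close> forces \<open>ZYu\<^sub>i Xu\<^sub>i = ZXu\<^sub>i Yu\<^sub>i\<close> everywhere.
  Hence the direction of \<open>\<nabla>u\<^sub>i\<close> depends only on \<open>x\<close>, and the bounds on \<open>Xu\<^sub>i\<close> and
  \<open>Yu\<^sub>i\<close> exclude that it is anywhere different from the \<open>x\<close> axis.
\<close>

text \<open>The fields X and Y are homogeneous of degree one under (x, y) -> (t x, t^2 y), whence
  the shape of the boxes and the gauge 1 + x^4 + y^2 of the cutoff. Such a box has volume of order
  R^3, so bounded gradients alone give too much energy. The competitor lowers the order to R^2, the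
  borderline at which a cutoff at a single scale gives only a bounded error and one spread over n
  scales gains a factor 1/n. Since u is only C^2, its Euler-Lagrange equation cannot be
  differentiated; the equations for the derivatives of u are derived weakly, by translating the test
  function. Translation in y is a symmetry of the problem, translation in x is not: the coefficient
  x^2 leaves a term 2 x u_y. This term and the factor x in Y u = x u_y give, after integration by
  parts, the two halves of the expression in the sign hypothesis. The integral inequality sees only
  the sum over i; the sign hypothesis for each i is what separates the components
  afterwards.\<close>

section \<open>Functions with continuous partial derivatives\<close>

text \<open>The partials are explicit arguments, so that \<open>ux\<close>, \<open>uxy\<close> and
  the like are named functions that enter integrands and can be differentiated again. The operators
  defined by \<open>deriv\<close> are reached through \<open>partial_eq\<close>.\<close>

definition has_C1_partials ::
    "(real \<times> real \<Rightarrow> 'b::real_normed_vector) \<Rightarrow> (real \<times> real \<Rightarrow> 'b) \<Rightarrow> (real \<times> real \<Rightarrow> 'b) \<Rightarrow> bool" where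
  "has_C1_partials f fx fy \<longleftrightarrow>
     (\<forall>p. (f has_derivative (\<lambda>h. fst h *\<^sub>R fx p + snd h *\<^sub>R fy p)) (at p)) \<and>
     continuous_on UNIV fx \<and> continuous_on UNIV fy"

lemma has_C1_partialsI:
  assumes "\<And>p. (f has_derivative (\<lambda>h. fst h *\<^sub>R fx p + snd h *\<^sub>R fy p)) (at p)"
    and "continuous_on UNIV fx" and "continuous_on UNIV fy"
  shows "has_C1_partials f fx fy"
  using assms by (simp add: has_C1_partials_def)

lemma has_C1_partials_derivative:
  "has_C1_partials f fx fy \<Longrightarrow> (f has_derivative (\<lambda>h. fst h *\<^sub>R fx p + snd h *\<^sub>R fy p)) (at p)"
  unfolding has_C1_partials_def by blast

lemma has_C1_partials_continuous:
  assumes "has_C1_partials f fx fy"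
  shows "continuous_on S f" "continuous_on S fx" "continuous_on S fy"
proof -
  have "continuous_on UNIV f"
    using assms unfolding has_C1_partials_def
    by (meson has_derivative_continuous continuous_at_imp_continuous_on)
  then show "continuous_on S f" "continuous_on S fx" "continuous_on S fy"
    using assms unfolding has_C1_partials_def by (auto intro: continuous_on_subset)
qed

lemma has_C1_partials_cong:
  assumes "has_C1_partials f fx fy" "\<And>p. fx p = gx p" "\<And>p. fy p = gy p"
  shows "has_C1_partials f gx gy"
proof -
  have "fx = gx" "fy = gy" using assms(2,3) by auto
  then show ?thesis using assms(1) by simp
qed

lemma has_C1_partials_const: "has_C1_partials (\<lambda>p. c) (\<lambda>p. 0) (\<lambda>p. 0)"
  by (rule has_C1_partialsI) auto

lemma has_C1_partials_fst: "has_C1_partials fst (\<lambda>p. 1) (\<lambda>p. 0 :: real)"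
  by (rule has_C1_partialsI) (auto intro!: derivative_eq_intros)

lemma has_C1_partials_snd: "has_C1_partials snd (\<lambda>p. 0) (\<lambda>p. 1 :: real)"
  by (rule has_C1_partialsI) (auto intro!: derivative_eq_intros)

lemma has_C1_partials_add:
  assumes "has_C1_partials f fx fy" "has_C1_partials g gx gy"
  shows "has_C1_partials (\<lambda>p. f p + g p) (\<lambda>p. fx p + gx p) (\<lambda>p. fy p + gy p)"
  by (rule has_C1_partialsI)
     (auto intro!: derivative_eq_intros continuous_intros
           has_C1_partials_derivative[OF assms(1)] has_C1_partials_derivative[OF assms(2)]
           has_C1_partials_continuous[OF assms(1)] has_C1_partials_continuous[OF assms(2)]
           simp: algebra_simps)

lemma has_C1_partials_bilinear:
  assumes "bounded_bilinear b" "has_C1_partials f fx fy" "has_C1_partials g gx gy"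
  shows "has_C1_partials (\<lambda>p. b (f p) (g p))
           (\<lambda>p. b (fx p) (g p) + b (f p) (gx p)) (\<lambda>p. b (fy p) (g p) + b (f p) (gy p))"
proof -
  interpret bounded_bilinear b by fact
  show ?thesis
    by (rule has_C1_partialsI)
       (auto intro!: continuous_intros continuous_on
             has_derivative_eq_rhs[OF FDERIV[OF has_C1_partials_derivative[OF assms(2)]
               has_C1_partials_derivative[OF assms(3)]]]
             has_C1_partials_continuous[OF assms(2)] has_C1_partials_continuous[OF assms(3)]
             simp: add_left add_right scaleR_left scaleR_right algebra_simps)
qed

lemmas has_C1_partials_scaleR = has_C1_partials_bilinear[OF bounded_bilinear_scaleR]
  and has_C1_partials_mult = has_C1_partials_bilinear[OF bounded_bilinear_mult]
  and has_C1_partials_inner = has_C1_partials_bilinear[OF bounded_bilinear_inner]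

lemma has_C1_partials_inner_const:
  assumes "has_C1_partials f fx fy"
  shows "has_C1_partials (\<lambda>p. f p \<bullet> b) (\<lambda>p. fx p \<bullet> b) (\<lambda>p. fy p \<bullet> b)"
  by (rule has_C1_partials_cong[OF has_C1_partials_inner[OF assms has_C1_partials_const[of b]]]) auto

lemma has_C1_partials_compose:
  fixes f :: "real \<times> real \<Rightarrow> real" and g :: "real \<Rightarrow> real"
  assumes f: "has_C1_partials f fx fy"
    and g: "\<And>p. (g has_real_derivative g' (f p)) (at (f p))"
    and g': "continuous_on UNIV (\<lambda>p. g' (f p))"
  shows "has_C1_partials (\<lambda>p. g (f p)) (\<lambda>p. g' (f p) * fx p) (\<lambda>p. g' (f p) * fy p)"
proof (rule has_C1_partialsI)
  show "((\<lambda>p. g (f p)) has_derivative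
           (\<lambda>h. fst h *\<^sub>R (g' (f p) * fx p) + snd h *\<^sub>R (g' (f p) * fy p))) (at p)" for p
    by (rule has_derivative_eq_rhs[OF has_derivative_compose[OF has_C1_partials_derivative[OF f]
          g[unfolded has_field_derivative_def]]]) (auto simp: algebra_simps)
qed (intro continuous_intros g' has_C1_partials_continuous[OF f])+

lemma has_C1_partials_translate:
  assumes "has_C1_partials f fx fy"
  shows "has_C1_partials (\<lambda>p. f (p + c)) (\<lambda>p. fx (p + c)) (\<lambda>p. fy (p + c))"
proof (rule has_C1_partialsI)
  show "((\<lambda>p. f (p + c)) has_derivative (\<lambda>h. fst h *\<^sub>R fx (p + c) + snd h *\<^sub>R fy (p + c))) (at p)" for p
    by (rule has_derivative_eq_rhs[OF has_derivative_compose[OF _ has_C1_partials_derivative[OF assms]]])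
       (auto intro!: derivative_eq_intros)
  show "continuous_on UNIV (\<lambda>p. fx (p + c))" "continuous_on UNIV (\<lambda>p. fy (p + c))"
    by (auto intro!: continuous_intros continuous_on_compose2[OF has_C1_partials_continuous(2)[OF assms]]
         continuous_on_compose2[OF has_C1_partials_continuous(3)[OF assms]])
qed

lemma has_C1_partials_line:
  assumes "has_C1_partials f fx fy"
  shows "((\<lambda>t. f (p + t *\<^sub>R e)) has_vector_derivative
           fst e *\<^sub>R fx (p + t *\<^sub>R e) + snd e *\<^sub>R fy (p + t *\<^sub>R e)) (at t within S)"
  unfolding has_vector_derivative_def
  by (rule has_derivative_at_withinI,
      rule has_derivative_eq_rhs[OF has_derivative_compose[OF _ has_C1_partials_derivative[OF assms]]])
     (auto intro!: derivative_eq_intros simp: algebra_simps)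

lemma has_C1_partials_x:
  assumes "has_C1_partials f fx fy"
  shows "((\<lambda>t. f (t, y)) has_vector_derivative fx (x, y)) (at x within S)"
  using has_C1_partials_line[OF assms, where p = "(0, y)" and e = "(1, 0)" and t = x and S = S] by simp

lemma has_C1_partials_y:
  assumes "has_C1_partials f fx fy"
  shows "((\<lambda>t. f (x, t)) has_vector_derivative fy (x, y)) (at y within S)"
  using has_C1_partials_line[OF assms, where p = "(x, 0)" and e = "(0, 1)" and t = y and S = S] by simp

lemma has_C1_partials_real:
  fixes f :: "real \<times> real \<Rightarrow> real"
  assumes "has_C1_partials f fx fy"
  shows "((\<lambda>t. f (t, y)) has_real_derivative fx (x, y)) (at x within S)"
    and "((\<lambda>t. f (x, t)) has_real_derivative fy (x, y)) (at y within S)"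
  using has_C1_partials_x[OF assms] has_C1_partials_y[OF assms]
  by (simp_all add: has_real_derivative_iff_has_vector_derivative)

lemma partial_eq:
  assumes "has_C1_partials f fx fy"
  shows "partial_x f = fx" "partial_y f = fy"
  by (auto simp: fun_eq_iff partial_x_def partial_y_def
       intro!: DERIV_imp_deriv has_C1_partials_real[OF assms])

lemma has_C1_partials_support:
  assumes f: "has_C1_partials f fx fy" and "closed S" and 0: "\<And>p. p \<notin> S \<Longrightarrow> f p = 0" and p: "p \<notin> S"
  shows "fx p = 0" "fy p = 0"
proof -
  have "((\<lambda>p. 0) has_derivative (\<lambda>h. fst h *\<^sub>R fx p + snd h *\<^sub>R fy p)) (at p)"
    by (rule has_derivative_transform_within_open[OF has_C1_partials_derivative[OF f] open_Compl[OF assms(2)]])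
       (use 0 p in auto)
  then have "(\<lambda>h. fst h *\<^sub>R fx p + snd h *\<^sub>R fy p) = (\<lambda>h. 0)"
    using has_derivative_unique has_derivative_const by blast
  from fun_cong[OF this, of "(1,0)"] fun_cong[OF this, of "(0,1)"] show "fx p = 0" "fy p = 0"
    by auto
qed

section \<open>Symmetry of the mixed partial derivatives\<close>

lemma second_difference_mean_value:
  fixes f :: "real \<times> real \<Rightarrow> real"
  assumes f: "has_C1_partials f fx fy" and fx: "has_C1_partials fx fxx fxy" and h: "h > 0"
  obtains a b where "x < a" "a < x + h" "y < b" "b < y + h"
    "f (x + h, y + h) - f (x + h, y) - f (x, y + h) + f (x, y) = h\<^sup>2 * fxy (a, b)"
proof -
  have "\<exists>a. a > x \<and> a < x + h \<and>
      (f (x + h, y + h) - f (x + h, y)) - (f (x, y + h) - f (x, y)) =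
      (x + h - x) * (fx (a, y + h) - fx (a, y))"
    by (rule MVT2) (use h in \<open>auto intro!: derivative_intros has_C1_partials_real[OF f]\<close>)
  then obtain a where a: "x < a" "a < x + h"
      "(f (x + h, y + h) - f (x + h, y)) - (f (x, y + h) - f (x, y)) = h * (fx (a, y + h) - fx (a, y))"
    by auto
  have "\<exists>b. b > y \<and> b < y + h \<and> fx (a, y + h) - fx (a, y) = (y + h - y) * fxy (a, b)"
    by (rule MVT2) (use h in \<open>auto intro!: derivative_intros has_C1_partials_real[OF fx]\<close>)
  then obtain b where b: "y < b" "b < y + h" "fx (a, y + h) - fx (a, y) = h * fxy (a, b)"
    by auto
  show ?thesis
    by (rule that[OF a(1,2) b(1,2)]) (use a(3) b(3) in \<open>simp add: power2_eq_square\<close>)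
qed

lemma has_C1_partials_swap:
  assumes "has_C1_partials f fx fy"
  shows "has_C1_partials (\<lambda>p. f (prod.swap p)) (\<lambda>p. fy (prod.swap p)) (\<lambda>p. fx (prod.swap p))"
proof (rule has_C1_partialsI)
  have s: "(prod.swap has_derivative prod.swap) (at p)" for p :: "real \<times> real"
    unfolding prod.swap_def by (auto intro!: derivative_eq_intros)
  show "((\<lambda>p. f (prod.swap p)) has_derivative
          (\<lambda>h. fst h *\<^sub>R fy (prod.swap p) + snd h *\<^sub>R fx (prod.swap p))) (at p)" for p
    by (rule has_derivative_eq_rhs[OF has_derivative_compose[OF s has_C1_partials_derivative[OF assms]]])
       (auto simp: algebra_simps)
  have c: "continuous_on UNIV (prod.swap :: real \<times> real \<Rightarrow> _)"
    unfolding prod.swap_def by (intro continuous_intros)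
  show "continuous_on UNIV (\<lambda>p. fy (prod.swap p))" "continuous_on UNIV (\<lambda>p. fx (prod.swap p))"
    by (auto intro!: c continuous_on_compose2[OF has_C1_partials_continuous(2)[OF assms]]
         continuous_on_compose2[OF has_C1_partials_continuous(3)[OF assms]])
qed

text \<open>The second difference over a square of side h is symmetric in the two variables. Two
  mean value theorems, taken in either order, express it through either mixed partial at some point
  of the square, and the squares shrink to p.\<close>

lemma mixed_partials_real:
  fixes f :: "real \<times> real \<Rightarrow> real"
  assumes f: "has_C1_partials f fx fy" and fx: "has_C1_partials fx fxx fxy"
    and fy: "has_C1_partials fy fyx fyy"
  shows "fxy p = fyx p"
proof -
  obtain x y where p: "p = (x, y)" by force
  define h where "h n = inverse (real (Suc n))" for n
  have h: "h n > 0" for n by (simp add: h_def)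
  have h0: "h \<longlonglongrightarrow> 0" unfolding h_def by (rule LIMSEQ_inverse_real_of_nat)
  define \<Delta> where "\<Delta> n = f (x + h n, y + h n) - f (x + h n, y) - f (x, y + h n) + f (x, y)" for n
  have "\<exists>a b. x < a \<and> a < x + h n \<and> y < b \<and> b < y + h n \<and> \<Delta> n = (h n)\<^sup>2 * fxy (a, b)" for n
    by (rule second_difference_mean_value[OF f fx h[of n], where x=x and y=y])  (auto simp: \<Delta>_def)
  then obtain a b where ab: "\<And>n. x < a n \<and> a n < x + h n \<and> y < b n \<and> b n < y + h n \<and>
      \<Delta> n = (h n)\<^sup>2 * fxy (a n, b n)" by metis
  have "\<exists>a b. x < a \<and> a < x + h n \<and> y < b \<and> b < y + h n \<and> \<Delta> n = (h n)\<^sup>2 * fyx (a, b)" for n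
    by (rule second_difference_mean_value[OF has_C1_partials_swap[OF f] has_C1_partials_swap[OF fy] h[of n], where x=y and y=x])
       (force simp: \<Delta>_def)
  then obtain c d where cd: "\<And>n. x < c n \<and> c n < x + h n \<and> y < d n \<and> d n < y + h n \<and>
      \<Delta> n = (h n)\<^sup>2 * fyx (c n, d n)" by metis
  have squeeze: "X \<longlonglongrightarrow> z" if "\<And>n. z < X n \<and> X n < z + h n" for X :: "nat \<Rightarrow> real" and z
    by (rule tendsto_sandwich[of "\<lambda>_. z" _ _ "\<lambda>n. z + h n"])
       (use that less_imp_le tendsto_add[OF tendsto_const h0, of z] in \<open>auto intro!: always_eventually\<close>)
  have "(\<lambda>n. (a n, b n)) \<longlonglongrightarrow> p" "(\<lambda>n. (c n, d n)) \<longlonglongrightarrow> p"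
    unfolding p using ab cd by (auto intro!: tendsto_Pair squeeze)
  moreover have "isCont fxy p" "isCont fyx p"
    using has_C1_partials_continuous(3)[OF fx] has_C1_partials_continuous(2)[OF fy]
    by (metis UNIV_I continuous_on_eq_continuous_at open_UNIV)+
  ultimately have "(\<lambda>n. fxy (a n, b n)) \<longlonglongrightarrow> fxy p" "(\<lambda>n. fyx (c n, d n)) \<longlonglongrightarrow> fyx p"
    by (auto intro: isCont_tendsto_compose)
  moreover have "fxy (a n, b n) = fyx (c n, d n)" for n
    using ab[of n] cd[of n] h[of n] by auto
  ultimately show ?thesis
    using LIMSEQ_unique by auto
qed

lemma mixed_partials:
  fixes f :: "real \<times> real \<Rightarrow> 'b::euclidean_space"
  assumes "has_C1_partials f fx fy" "has_C1_partials fx fxx fxy" "has_C1_partials fy fyx fyy"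
  shows "fxy p = fyx p"
  by (rule euclidean_eqI)
     (use mixed_partials_real[OF assms[THEN has_C1_partials_inner_const]] in blast)

section \<open>First and second variation\<close>

lemma integral_UNIV_support:
  fixes f :: "'a::euclidean_space \<Rightarrow> real"
  assumes "\<And>p. p \<notin> cbox a b \<Longrightarrow> f p = 0"
  shows "integral UNIV f = integral (cbox a b) f"
proof -
  have "f = (\<lambda>p. if p \<in> cbox a b then f p else 0)"
    using assms by auto
  then show ?thesis
    using integral_restrict_UNIV[of "cbox a b" f] by simp
qed

lemma integrable_UNIV_support:
  fixes f :: "'a::euclidean_space \<Rightarrow> real"
  assumes "continuous_on UNIV f" and "\<And>p. p \<notin> cbox a b \<Longrightarrow> f p = 0"
  shows "f integrable_on UNIV"
  by (rule integrable_on_superset[of f "cbox a b"])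
     (use assms in \<open>auto intro: integrable_continuous continuous_on_subset\<close>)

text \<open>Outside the box f is 0 for all parameters near h, so its derivative vanishes there too,
  and both integrals reduce to a compact box on which the usual Leibniz rule applies.\<close>

lemma leibniz_rule_support:
  fixes f :: "real \<Rightarrow> 'a::euclidean_space \<Rightarrow> real"
  assumes deriv: "\<And>h p. ((\<lambda>h. f h p) has_real_derivative f' h p) (at h)"
    and cont: "\<And>h. continuous_on UNIV (f h)" and cont': "continuous_on UNIV (\<lambda>(h, p). f' h p)"
    and supp: "\<And>h p. h \<in> {-1<..<1} \<Longrightarrow> p \<notin> cbox a b \<Longrightarrow> f h p = 0"
    and h: "h \<in> {-1<..<1}"
  shows "((\<lambda>h. integral UNIV (f h)) has_real_derivative integral UNIV (f' h)) (at h)"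
proof -
  have "f' h p = 0" if "p \<notin> cbox a b" for p
  proof (rule DERIV_unique[OF deriv])
    show "((\<lambda>h. f h p) has_real_derivative 0) (at h)"
      by (rule has_field_derivative_transform_within_open[of "\<lambda>_. 0" _ _ "{-1<..<1}"])
         (use h supp that in auto)
  qed
  then have "integral UNIV (f' h) = integral (cbox a b) (f' h)"
    by (rule integral_UNIV_support)
  moreover have "((\<lambda>h. integral (cbox a b) (f h)) has_real_derivative integral (cbox a b) (f' h))
      (at h within {-1<..<1})"
  proof (rule leibniz_rule_field_derivative)
    show "f h integrable_on cbox a b" for h
      by (rule integrable_continuous, rule continuous_on_subset[OF cont]) simp
    show "continuous_on ({-1<..<1} \<times> cbox a b) (\<lambda>(h, p). f' h p)"
      by (rule continuous_on_subset[OF cont']) simp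
  qed (use h in \<open>auto intro: has_field_derivative_at_within[OF deriv]\<close>)
  then have "((\<lambda>h. integral (cbox a b) (f h)) has_real_derivative integral (cbox a b) (f' h)) (at h)"
    using h by (simp add: at_within_open[of h "{-1<..<1}"])
  then have "((\<lambda>h. integral UNIV (f h)) has_real_derivative integral (cbox a b) (f' h)) (at h)"
    by (rule has_field_derivative_transform_within_open[of _ _ _ "{-1<..<1}"])
       (use h in \<open>auto intro!: integral_UNIV_support[symmetric] supp\<close>)
  ultimately show ?thesis by simp
qed

lemma integral_UNIV_translate:
  fixes f :: "'a::euclidean_space \<Rightarrow> real"
  assumes "\<And>p. p \<notin> cbox a b \<Longrightarrow> f p = 0"
  shows "integral UNIV (\<lambda>p. f (p + c)) = integral UNIV f"
proof -
  have "integral UNIV (\<lambda>p. f (p + c)) = integral (cbox (a - c) (b - c)) (\<lambda>p. f (p + c))"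
    by (rule integral_UNIV_support, rule assms) (auto simp: mem_box algebra_simps)
  also have "\<dots> = integral (cbox a b) f"
    using integral_shift_cbox_plus[of "a - c" "b - c" f c] by (simp add: o_def add.commute)
  finally show ?thesis
    using integral_UNIV_support[of a b f] assms by simp
qed

text \<open>Provides one box, independent of h, for the supports of all translates by h e with |h|
  \<le> 1.\<close>

lemma translate_in_enlarged_box:
  fixes e :: "real \<times> real"
  assumes "p + h *\<^sub>R e \<in> cbox a b" "\<bar>h\<bar> \<le> 1" "\<bar>fst e\<bar> \<le> 1" "\<bar>snd e\<bar> \<le> 1"
  shows "p \<in> cbox (a - (1, 1)) (b + (1, 1))"
proof -
  have "\<bar>h * fst e\<bar> \<le> 1" "\<bar>h * snd e\<bar> \<le> 1"
    using assms(2-4) by (auto simp: abs_mult intro!: mult_le_one)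
  then show ?thesis
    using assms(1) by (cases a; cases b; cases p; cases e) (auto simp: abs_le_iff)
qed

text \<open>Translation invariance makes the integral of f (p + h e) independent of h, and the
  integral in question is its derivative at h = 0. This yields integration by parts without iterated
  integrals.\<close>

lemma integral_directional_derivative_eq_0:
  fixes f :: "real \<times> real \<Rightarrow> real"
  assumes f: "has_C1_partials f fx fy" and supp: "\<And>p. p \<notin> cbox a b \<Longrightarrow> f p = 0"
    and e: "\<bar>fst e\<bar> \<le> 1" "\<bar>snd e\<bar> \<le> 1"
  shows "integral UNIV (\<lambda>p. fst e * fx p + snd e * fy p) = 0"
proof -
  have "((\<lambda>h. integral UNIV (\<lambda>p. f (p + h *\<^sub>R e))) has_real_derivative
      integral UNIV (\<lambda>p. fst e * fx (p + 0 *\<^sub>R e) + snd e * fy (p + 0 *\<^sub>R e))) (at 0)"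
  proof (rule leibniz_rule_support[where a = "a - (1, 1)" and b = "b + (1, 1)"])
    show "((\<lambda>h. f (p + h *\<^sub>R e)) has_real_derivative
        fst e * fx (p + h *\<^sub>R e) + snd e * fy (p + h *\<^sub>R e)) (at h)" for h p
      using has_C1_partials_line[OF f, of p e h UNIV]
      by (simp add: has_real_derivative_iff_has_vector_derivative)
    show "f (p + h *\<^sub>R e) = 0" if "h \<in> {-1<..<1}" "p \<notin> cbox (a - (1, 1)) (b + (1, 1))" for h p
      by (rule supp) (use translate_in_enlarged_box[of p h e a b] e that in \<open>auto simp: abs_less_iff abs_le_iff\<close>)
    show "continuous_on UNIV (\<lambda>(h, p). fst e * fx (p + h *\<^sub>R e) + snd e * fy (p + h *\<^sub>R e))"
      unfolding split_beta
      by (auto intro!: continuous_intros continuous_on_compose2[OF has_C1_partials_continuous(2)[OF f]]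
         continuous_on_compose2[OF has_C1_partials_continuous(3)[OF f]])
    show "continuous_on UNIV (\<lambda>p. f (p + h *\<^sub>R e))" for h
      by (auto intro!: continuous_intros continuous_on_compose2[OF has_C1_partials_continuous(1)[OF f]])
  qed auto
  then have "((\<lambda>h. integral UNIV f) has_real_derivative
      integral UNIV (\<lambda>p. fst e * fx p + snd e * fy p)) (at 0)"
    using integral_UNIV_translate[of a b f] supp by simp
  then show ?thesis
    using DERIV_unique DERIV_const by blast
qed

lemma integral_partials_eq_0:
  fixes f :: "real \<times> real \<Rightarrow> real"
  assumes "has_C1_partials f fx fy" and "\<And>p. p \<notin> cbox a b \<Longrightarrow> f p = 0"
  shows "integral UNIV fx = 0" "integral UNIV fy = 0"
  using integral_directional_derivative_eq_0[OF assms, where e = "(1, 0)"]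
    integral_directional_derivative_eq_0[OF assms, where e = "(0, 1)"] by simp_all

text \<open>\<open>f'\<close> is differentiated at 0 only. If c were negative, \<open>f'\<close>
  would be negative just to the right of 0, and the mean value theorem would make f drop below its
  minimum.\<close>

lemma second_derivative_nonneg_at_min:
  fixes f :: "real \<Rightarrow> real"
  assumes f: "\<And>t. t \<in> {-1<..<1} \<Longrightarrow> (f has_real_derivative f' t) (at t)"
    and f': "(f' has_real_derivative c) (at 0)"
    and min: "\<And>t. t \<in> {-1<..<1} \<Longrightarrow> f 0 \<le> f t"
  shows "f' 0 = 0" "c \<ge> 0"
proof -
  show f'0: "f' 0 = 0"
    by (rule DERIV_local_min[OF f, of 0 1]) (use min in \<open>auto simp: abs_less_iff\<close>)
  show "c \<ge> 0"
  proof (rule ccontr)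
    assume "\<not> c \<ge> 0"
    then obtain d where d: "d > 0" "\<And>h. h > 0 \<Longrightarrow> h < d \<Longrightarrow> f' h < 0"
      using DERIV_neg_dec_right[OF f'] f'0 by auto
    define h where "h = min (d/2) (1/2)"
    have h: "0 < h" "h < d" "h < 1" using d(1) by (auto simp: h_def)
    have "\<exists>z. 0 < z \<and> z < h \<and> f h - f 0 = (h - 0) * f' z"
      by (rule MVT2) (use h in \<open>auto intro!: f\<close>)
    then obtain z where "0 < z" "z < h" "f h - f 0 = h * f' z" by auto
    moreover have "h * f' z < 0"
      using d(2)[of z] h calculation by (auto simp: mult_pos_neg)
    ultimately show False using min[of h] h by auto
  qed
qed

definition grushin_density ::
    "('b::real_normed_vector \<Rightarrow> real) \<Rightarrow> (real \<times> real \<Rightarrow> 'b) \<Rightarrow> (real \<times> real \<Rightarrow> 'b) \<Rightarrow>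
     (real \<times> real \<Rightarrow> 'b) \<Rightarrow> real \<times> real \<Rightarrow> real" where
  "grushin_density H v vx vy p = 1/2 * ((norm (vx p))\<^sup>2 + (fst p)\<^sup>2 * (norm (vy p))\<^sup>2) + H (v p)"

text \<open>Minimality is recorded in the form in which it is used: C^1 perturbations supported in a
  box, and finite integrals over that box. One function \<open>uxy\<close> serves as both mixed
  partials.\<close>

locale grushin_minimizer =
  fixes H :: "'b::euclidean_space \<Rightarrow> real"
    and dH :: "'b \<Rightarrow> 'b \<Rightarrow>\<^sub>L real" and d2H :: "'b \<Rightarrow> 'b \<Rightarrow>\<^sub>L 'b \<Rightarrow>\<^sub>L real"
    and u ux uy uxx uxy uyy :: "real \<times> real \<Rightarrow> 'b"
  assumes dH: "\<And>w. (H has_derivative dH w) (at w)"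
    and d2H: "\<And>w. (dH has_derivative d2H w) (at w)"
    and cont_d2H: "continuous_on UNIV d2H"
    and u: "has_C1_partials u ux uy"
    and ux: "has_C1_partials ux uxx uxy"
    and uy: "has_C1_partials uy uxy uyy"
    and minimal: "\<And>\<phi> \<phi>x \<phi>y a b. has_C1_partials \<phi> \<phi>x \<phi>y \<Longrightarrow> (\<And>p. p \<notin> box a b \<Longrightarrow> \<phi> p = 0) \<Longrightarrow>
      integral (cbox a b) (grushin_density H u ux uy) \<le>
      integral (cbox a b) (grushin_density H (\<lambda>p. u p + \<phi> p) (\<lambda>p. ux p + \<phi>x p) (\<lambda>p. uy p + \<phi>y p))"
begin

lemma cont_dH: "continuous_on UNIV dH"
  by (meson d2H has_derivative_continuous continuous_at_imp_continuous_on)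

lemma cont_H: "continuous_on UNIV H"
  by (meson dH has_derivative_continuous continuous_at_imp_continuous_on)

lemmas cont_u = has_C1_partials_continuous[OF u] has_C1_partials_continuous(2,3)[OF ux]
  has_C1_partials_continuous(3)[OF uy]

lemma variations:
  assumes \<psi>: "has_C1_partials \<psi> \<psi>x \<psi>y" and supp: "\<And>p. p \<notin> cbox a b \<Longrightarrow> \<psi> p = 0"
  shows first_variation:
      "integral UNIV (\<lambda>p. ux p \<bullet> \<psi>x p + (fst p)\<^sup>2 * (uy p \<bullet> \<psi>y p) + dH (u p) (\<psi> p)) = 0"
    and second_variation:
      "integral UNIV (\<lambda>p. \<psi>x p \<bullet> \<psi>x p + (fst p)\<^sup>2 * (\<psi>y p \<bullet> \<psi>y p) + d2H (u p) (\<psi> p) (\<psi> p)) \<ge> 0"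
proof -
  note cont_\<psi> = has_C1_partials_continuous[OF \<psi>]
  note supp' = supp has_C1_partials_support[OF \<psi> closed_cbox supp]
  \<comment> \<open>\<open>f0 t\<close> is the energy density of u + t \<psi> minus that of u, with
    the quadratic part expanded. Subtracting before integrating makes it compactly supported,
    whatever the total energy of u. \<open>f1\<close> and \<open>f2\<close> are its derivatives in
    t.\<close>
  define f0 where "f0 t p = t * (ux p \<bullet> \<psi>x p + (fst p)\<^sup>2 * (uy p \<bullet> \<psi>y p)) +
    t\<^sup>2 / 2 * (\<psi>x p \<bullet> \<psi>x p + (fst p)\<^sup>2 * (\<psi>y p \<bullet> \<psi>y p)) + (H (u p + t *\<^sub>R \<psi> p) - H (u p))" for t p
  define f1 where "f1 t p = ux p \<bullet> \<psi>x p + (fst p)\<^sup>2 * (uy p \<bullet> \<psi>y p) +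
    t * (\<psi>x p \<bullet> \<psi>x p + (fst p)\<^sup>2 * (\<psi>y p \<bullet> \<psi>y p)) + dH (u p + t *\<^sub>R \<psi> p) (\<psi> p)" for t p
  define f2 where "f2 t p = \<psi>x p \<bullet> \<psi>x p + (fst p)\<^sup>2 * (\<psi>y p \<bullet> \<psi>y p) +
    d2H (u p + t *\<^sub>R \<psi> p) (\<psi> p) (\<psi> p)" for t p
  have cont0: "continuous_on UNIV (f0 t)" for t
    unfolding f0_def by (auto intro!: continuous_intros cont_u cont_\<psi> continuous_on_compose2[OF cont_H])
  have cont1: "continuous_on UNIV (f1 t)" for t
    unfolding f1_def
    by (auto intro!: continuous_intros cont_u cont_\<psi> continuous_on_compose2[OF cont_dH])
  have cont1': "continuous_on UNIV (\<lambda>(t, p). f1 t p)"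
    unfolding f1_def split_beta
    by (auto intro!: continuous_intros continuous_on_compose2[OF cont_dH]
      cont_u[THEN continuous_on_compose2] cont_\<psi>[THEN continuous_on_compose2])
  have cont2: "continuous_on UNIV (\<lambda>(t, p). f2 t p)"
    unfolding f2_def split_beta
    by (auto intro!: continuous_intros continuous_on_compose2[OF cont_d2H]
      cont_u[THEN continuous_on_compose2] cont_\<psi>[THEN continuous_on_compose2])
  have D0: "((\<lambda>t. f0 t p) has_real_derivative f1 t p) (at t)" for t p
  proof -
    have "((\<lambda>t. H (u p + t *\<^sub>R \<psi> p)) has_derivative (\<lambda>s. dH (u p + t *\<^sub>R \<psi> p) (s *\<^sub>R \<psi> p))) (at t)"
      by (rule has_derivative_compose[OF _ dH]) (auto intro!: derivative_eq_intros)
    then have "((\<lambda>t. H (u p + t *\<^sub>R \<psi> p)) has_real_derivative dH (u p + t *\<^sub>R \<psi> p) (\<psi> p)) (at t)"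
      by (simp add: has_field_derivative_def blinfun.scaleR_right mult.commute[of "dH _ _"]
          mult_commute_abs)
    then show ?thesis
      unfolding f0_def f1_def by (auto intro!: derivative_eq_intros)
  qed
  have D1: "((\<lambda>t. f1 t p) has_real_derivative f2 t p) (at t)" for t p
  proof -
    have "((\<lambda>t. dH (u p + t *\<^sub>R \<psi> p)) has_derivative (\<lambda>s. d2H (u p + t *\<^sub>R \<psi> p) (s *\<^sub>R \<psi> p))) (at t)"
      by (rule has_derivative_compose[OF _ d2H]) (auto intro!: derivative_eq_intros)
    then have "((\<lambda>t. dH (u p + t *\<^sub>R \<psi> p) (\<psi> p)) has_derivative
        (\<lambda>s. d2H (u p + t *\<^sub>R \<psi> p) (s *\<^sub>R \<psi> p) (\<psi> p))) (at t)"
      by (rule bounded_linear.has_derivative[OF bounded_bilinear.bounded_linear_left[OF bounded_bilinear_blinfun_apply]])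
    then have "((\<lambda>t. dH (u p + t *\<^sub>R \<psi> p) (\<psi> p)) has_real_derivative
        d2H (u p + t *\<^sub>R \<psi> p) (\<psi> p) (\<psi> p)) (at t)"
      by (simp add: has_field_derivative_def blinfun.scaleR_right blinfun.scaleR_left mult_commute_abs)
    then show ?thesis
      unfolding f1_def f2_def by (auto intro!: derivative_eq_intros)
  qed
  have I0: "((\<lambda>t. integral UNIV (f0 t)) has_real_derivative integral UNIV (f1 t)) (at t)"
    if "t \<in> {-1<..<1}" for t
    by (rule leibniz_rule_support[OF D0 cont0 cont1' _ that, where a = a and b = b])
       (simp add: f0_def supp')
  have I1: "((\<lambda>t. integral UNIV (f1 t)) has_real_derivative integral UNIV (f2 0)) (at 0)"
    by (rule leibniz_rule_support[OF D1 cont1 cont2, where a = a and b = b])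
       (simp_all add: f1_def supp')
  have "integral UNIV (f0 t) \<ge> integral UNIV (f0 0)" for t
  proof -
    \<comment> \<open>\<open>supp\<close> gives zeros outside a closed box, while
      \<open>minimal\<close> asks for zeros outside an open one; hence the enlargement.\<close>
    define a' b' where "a' = a - (1, 1)" and "b' = b + (1, 1)"
    have ab: "cbox a b \<subseteq> box a' b'"
      by (cases a; cases b) (auto simp: a'_def b'_def mem_box Basis_prod_def ball_Un)
    then have ab': "cbox a b \<subseteq> cbox a' b'" using box_subset_cbox by blast
    let ?v = "grushin_density H (\<lambda>p. u p + t *\<^sub>R \<psi> p) (\<lambda>p. ux p + t *\<^sub>R \<psi>x p) (\<lambda>p. uy p + t *\<^sub>R \<psi>y p)"
    let ?u = "grushin_density H u ux uy"
    have int: "?u integrable_on cbox a' b'" "?v integrable_on cbox a' b'"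
      unfolding grushin_density_def
      by (auto intro!: integrable_continuous continuous_intros cont_u cont_\<psi> continuous_on_compose2[OF cont_H])
    have "integral (cbox a' b') ?u \<le> integral (cbox a' b') ?v"
    proof (rule minimal)
      show "has_C1_partials (\<lambda>p. t *\<^sub>R \<psi> p) (\<lambda>p. t *\<^sub>R \<psi>x p) (\<lambda>p. t *\<^sub>R \<psi>y p)"
        using has_C1_partials_scaleR[OF has_C1_partials_const[of t] \<psi>] by simp
      show "t *\<^sub>R \<psi> p = 0" if "p \<notin> box a' b'" for p
        using supp[of p] that ab by auto
    qed
    then have "0 \<le> integral (cbox a' b') (\<lambda>p. ?v p - ?u p)"
      using int by (simp add: integral_diff)
    also have "(\<lambda>p. ?v p - ?u p) = f0 t"
      unfolding grushin_density_def f0_def power2_norm_eq_inner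
      by (auto simp: fun_eq_iff inner_add_left inner_add_right inner_commute algebra_simps power2_eq_square)
    also have "integral (cbox a' b') (f0 t) = integral UNIV (f0 t)"
    proof (rule integral_UNIV_support[symmetric])
      show "f0 t p = 0" if "p \<notin> cbox a' b'" for p
      proof -
        have "p \<notin> cbox a b" using that ab' by blast
        then show ?thesis by (simp add: f0_def supp')
      qed
    qed
    finally show ?thesis by (simp add: f0_def[abs_def])
  qed
  from second_derivative_nonneg_at_min[OF I0 I1 this]
  show "integral UNIV (\<lambda>p. ux p \<bullet> \<psi>x p + (fst p)\<^sup>2 * (uy p \<bullet> \<psi>y p) + dH (u p) (\<psi> p)) = 0"
    and "integral UNIV (\<lambda>p. \<psi>x p \<bullet> \<psi>x p + (fst p)\<^sup>2 * (\<psi>y p \<bullet> \<psi>y p) + d2H (u p) (\<psi> p) (\<psi> p)) \<ge> 0"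
    by (simp_all add: f1_def[abs_def] f2_def[abs_def])
qed

text \<open>Formally these are the x- and y-derivatives of the Euler-Lagrange equation. The first
  variation is tested with translates of \<psi>; a change of variables moves the translation onto u
  and the coefficient, where one more derivative is available. The term with
  \<open>2 * fst p\<close> is the derivative of the coefficient.\<close>

lemma linearized_equation:
  assumes \<psi>: "has_C1_partials \<psi> \<psi>x \<psi>y" and supp: "\<And>p. p \<notin> cbox a b \<Longrightarrow> \<psi> p = 0"
  shows "integral UNIV (\<lambda>p. uxx p \<bullet> \<psi>x p + (2 * fst p) * (uy p \<bullet> \<psi>y p) + (fst p)\<^sup>2 * (uxy p \<bullet> \<psi>y p) +
           d2H (u p) (ux p) (\<psi> p)) = 0"
    and "integral UNIV (\<lambda>p. uxy p \<bullet> \<psi>x p + (fst p)\<^sup>2 * (uyy p \<bullet> \<psi>y p) + d2H (u p) (uy p) (\<psi> p)) = 0"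
proof -
  note cont_\<psi> = has_C1_partials_continuous[OF \<psi>]
  note supp' = supp has_C1_partials_support[OF \<psi> closed_cbox supp]
  \<comment> \<open>Keeping the coefficient inside \<open>F\<close> lets it be translated together
    with \<open>uy\<close>.\<close>
  define F where "F p = (fst p)\<^sup>2 *\<^sub>R uy p" for p
  define Fx where "Fx p = (2 * fst p) *\<^sub>R uy p + (fst p)\<^sup>2 *\<^sub>R uxy p" for p
  define Fy where "Fy p = (fst p)\<^sup>2 *\<^sub>R uyy p" for p
  define G where "G p = dH (u p)" for p
  define Gx where "Gx p = d2H (u p) (ux p)" for p
  define Gy where "Gy p = d2H (u p) (uy p)" for p
  have "has_C1_partials (\<lambda>p. (fst p * fst p) *\<^sub>R uy p) Fx Fy"
    by (rule has_C1_partials_cong[OF has_C1_partials_scaleR[OF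
          has_C1_partials_mult[OF has_C1_partials_fst has_C1_partials_fst] uy]])
       (auto simp: Fx_def Fy_def power2_eq_square algebra_simps)
  then have F: "has_C1_partials F Fx Fy" by (simp add: F_def[abs_def] power2_eq_square)
  have G: "has_C1_partials G Gx Gy"
  proof (rule has_C1_partialsI)
    show "(G has_derivative (\<lambda>h. fst h *\<^sub>R Gx p + snd h *\<^sub>R Gy p)) (at p)" for p
      unfolding G_def
      by (rule has_derivative_eq_rhs[OF has_derivative_compose[OF has_C1_partials_derivative[OF u] d2H]])
         (auto simp: Gx_def Gy_def blinfun.add_right blinfun.scaleR_right)
  qed (auto simp: Gx_def Gy_def intro!: continuous_intros cont_u continuous_on_compose2[OF cont_d2H])
  have "integral UNIV (\<lambda>p. (fst e *\<^sub>R uxx p + snd e *\<^sub>R uxy p) \<bullet> \<psi>x p +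
      (fst e *\<^sub>R Fx p + snd e *\<^sub>R Fy p) \<bullet> \<psi>y p +
      (fst e *\<^sub>R Gx p + snd e *\<^sub>R Gy p) (\<psi> p)) = 0" (is "?I e = 0")
    if e: "\<bar>fst e\<bar> \<le> 1" "\<bar>snd e\<bar> \<le> 1" for e
  proof -
    define g where "g h p = ux (p + h *\<^sub>R e) \<bullet> \<psi>x p + F (p + h *\<^sub>R e) \<bullet> \<psi>y p + G (p + h *\<^sub>R e) (\<psi> p)" for h p
    define g' where "g' h p = (fst e *\<^sub>R uxx (p + h *\<^sub>R e) + snd e *\<^sub>R uxy (p + h *\<^sub>R e)) \<bullet> \<psi>x p +
      (fst e *\<^sub>R Fx (p + h *\<^sub>R e) + snd e *\<^sub>R Fy (p + h *\<^sub>R e)) \<bullet> \<psi>y p +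
      (fst e *\<^sub>R Gx (p + h *\<^sub>R e) + snd e *\<^sub>R Gy (p + h *\<^sub>R e)) (\<psi> p)" for h p
    have D: "((\<lambda>h. integral UNIV (g h)) has_real_derivative integral UNIV (g' 0)) (at 0)"
    proof (rule leibniz_rule_support)
      show "((\<lambda>h. g h p) has_real_derivative g' h p) (at h)" for h p
        unfolding g_def g'_def has_real_derivative_iff_has_vector_derivative
        by (intro has_vector_derivative_add has_C1_partials_line[OF ux] has_C1_partials_line[OF F]
            has_C1_partials_line[OF G] bounded_linear.has_vector_derivative[OF bounded_linear_inner_left]
            bounded_linear.has_vector_derivative[OF bounded_bilinear.bounded_linear_left[OF bounded_bilinear_blinfun_apply]])
      show "continuous_on UNIV (g h)" for h
        unfolding g_def
        by (auto intro!: continuous_intros cont_\<psi> continuous_on_compose2[OF has_C1_partials_continuous(1)[OF ux]]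
           continuous_on_compose2[OF has_C1_partials_continuous(1)[OF F]]
           continuous_on_compose2[OF has_C1_partials_continuous(1)[OF G]])
      show "continuous_on UNIV (\<lambda>(h, p). g' h p)"
        unfolding g'_def split_beta
        by (auto intro!: continuous_intros cont_\<psi>[THEN continuous_on_compose2]
           has_C1_partials_continuous(2,3)[OF ux, THEN continuous_on_compose2]
           has_C1_partials_continuous(2,3)[OF F, THEN continuous_on_compose2]
           has_C1_partials_continuous(2,3)[OF G, THEN continuous_on_compose2])
      show "g h p = 0" if "p \<notin> cbox a b" for h p
        using that by (simp add: g_def supp')
    qed auto
    have zero: "integral UNIV (g h) = 0" if h: "h \<in> {-1<..<1}" for h
    proof -
      \<comment> \<open>\<open>k\<close> is the first-variation integrand for \<psi> shifted by h e;
        translating it back turns it into \<open>g h\<close>.\<close>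
      define k where "k p = ux p \<bullet> \<psi>x (p - h *\<^sub>R e) + (fst p)\<^sup>2 * (uy p \<bullet> \<psi>y (p - h *\<^sub>R e)) +
        dH (u p) (\<psi> (p - h *\<^sub>R e))" for p
      have out: "p - h *\<^sub>R e \<notin> cbox a b" if "p \<notin> cbox (a - (1, 1)) (b + (1, 1))" for p
        using translate_in_enlarged_box[of p "-h" e a b] that h e by (auto simp: abs_le_iff)
      have "integral UNIV k = 0"
        unfolding k_def
        using first_variation[OF has_C1_partials_translate[OF \<psi>, of "- h *\<^sub>R e"],
            of "a - (1, 1)" "b + (1, 1)"] supp out by simp
      moreover have "k p = 0" if "p \<notin> cbox (a - (1, 1)) (b + (1, 1))" for p
        using out[OF that] by (simp add: k_def supp')
      ultimately have "integral UNIV (\<lambda>p. k (p + h *\<^sub>R e)) = 0"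
        using integral_UNIV_translate[of _ _ k] by metis
      then show ?thesis
        by (simp add: k_def g_def[abs_def] F_def G_def)
    qed
    have "((\<lambda>h. integral UNIV (g h)) has_real_derivative 0) (at 0)"
      by (rule has_field_derivative_transform_within_open[of "\<lambda>_. 0" _ _ "{-1<..<1}"])
         (simp_all add: zero)
    from DERIV_unique[OF D this] have "integral UNIV (g' 0) = 0" .
    then show ?thesis by (simp add: g'_def[abs_def])
  qed
  from this[of "(1, 0)"] this[of "(0, 1)"]
  show "integral UNIV (\<lambda>p. uxx p \<bullet> \<psi>x p + (2 * fst p) * (uy p \<bullet> \<psi>y p) + (fst p)\<^sup>2 * (uxy p \<bullet> \<psi>y p) +
           d2H (u p) (ux p) (\<psi> p)) = 0"
    and "integral UNIV (\<lambda>p. uxy p \<bullet> \<psi>x p + (fst p)\<^sup>2 * (uyy p \<bullet> \<psi>y p) + d2H (u p) (uy p) (\<psi> p)) = 0"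
    by (simp_all add: Fx_def Gx_def Fy_def Gy_def inner_add_left add.assoc)
qed

end

section \<open>Logarithmic cutoffs\<close>

lemma has_C1_partials_power2:
  fixes f :: "real \<times> real \<Rightarrow> real"
  assumes "has_C1_partials f fx fy"
  shows "has_C1_partials (\<lambda>p. (f p)\<^sup>2) (\<lambda>p. 2 * f p * fx p) (\<lambda>p. 2 * f p * fy p)"
  by (rule has_C1_partials_compose[OF assms])
     (auto intro!: derivative_eq_intros continuous_intros has_C1_partials_continuous[OF assms])

text \<open>Test functions need only one continuous derivative, so squared positive parts suffice to
  build all the cutoffs below.\<close>

lemma DERIV_max_0_squared: "((\<lambda>t::real. (max 0 t)\<^sup>2) has_real_derivative 2 * max 0 t) (at t)"
proof -
  consider "t > 0" | "t < 0" | "t = 0" by linarith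
  then show ?thesis
  proof cases
    case 1
    have "((\<lambda>t. t\<^sup>2) has_real_derivative 2 * max 0 t) (at t)"
      using 1 by (auto intro!: derivative_eq_intros)
    then show ?thesis
      by (rule has_field_derivative_transform_within_open[of _ _ _ "{0<..}"]) (use 1 in auto)
  next
    case 2
    have "((\<lambda>t. 0) has_real_derivative 2 * max 0 t) (at t)"
      using 2 by (auto intro!: derivative_eq_intros)
    then show ?thesis
      by (rule has_field_derivative_transform_within_open[of _ _ _ "{..<0}"]) (use 2 in auto)
  next
    case 3
    have "((\<lambda>h. (max 0 h)\<^sup>2 / h) \<longlongrightarrow> 0) (at (0::real))"
    proof (rule Lim_null_comparison[of _ "\<lambda>h. \<bar>h\<bar>"])
      show "\<forall>\<^sub>F h::real in at 0. norm ((max 0 h)\<^sup>2 / h) \<le> \<bar>h\<bar>"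
        by (rule always_eventually) (auto simp: max_def power2_eq_square)
    qed (auto intro!: tendsto_eq_intros)
    then show ?thesis using 3 by (simp add: DERIV_def)
  qed
qed

text \<open>The left side of the second bound is |grad_G s|^2, and both terms are controlled by x^2
  \<le> sqrt s. The right side is written so that division by s^2 bounds |grad_G ln s|^2. The
  summand 1 in s keeps ln s defined and nonnegative at the origin.\<close>

lemma grushin_gauge_bounds:
  fixes x y s :: real
  assumes s: "s = 1 + x ^ 4 + y\<^sup>2"
  shows "s \<ge> 1" and "16 * x ^ 6 + 4 * x\<^sup>2 * y\<^sup>2 \<le> 20 * s\<^sup>2 / sqrt s"
proof -
  show s1: "s \<ge> 1" using s by simp
  have "x\<^sup>2 = sqrt (x ^ 4)" by (rule real_sqrt_unique[symmetric]) auto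
  then have x2: "x\<^sup>2 \<le> sqrt s" using s by simp
  have "x ^ 4 \<le> s" "y\<^sup>2 \<le> s" using s by simp_all
  then have a: "x\<^sup>2 * x ^ 4 \<le> sqrt s * s" and b: "x\<^sup>2 * y\<^sup>2 \<le> sqrt s * s"
    using x2 s1 by (intro mult_mono; simp)+
  have "s\<^sup>2 / sqrt s = s * (s / sqrt s)" by (simp add: power2_eq_square)
  then have "s\<^sup>2 / sqrt s = sqrt s * s"
    using s1 by (simp add: real_div_sqrt mult.commute)
  then have c: "20 * s\<^sup>2 / sqrt s = 20 * (sqrt s * s)"
    by (metis times_divide_eq_right)
  have "x ^ 6 = x\<^sup>2 * x ^ 4" by (simp flip: power_add)
  then show "16 * x ^ 6 + 4 * x\<^sup>2 * y\<^sup>2 \<le> 20 * s\<^sup>2 / sqrt s"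
    unfolding c using a b by linarith
qed

definition grushin_box :: "real \<Rightarrow> (real \<times> real) set" where
  "grushin_box R = cbox (- R, - R\<^sup>2) (R, R\<^sup>2)"

lemma grushin_box_gauge:
  assumes "1 + (fst p) ^ 4 + (snd p)\<^sup>2 \<le> R ^ 4" "R \<ge> 0"
  shows "p \<in> grushin_box R"
proof -
  have "\<bar>fst p\<bar> ^ 4 \<le> R ^ 4" "\<bar>snd p\<bar>\<^sup>2 \<le> (R\<^sup>2)\<^sup>2"
  proof -
    have "0 \<le> (fst p) ^ 4" "0 \<le> (snd p)\<^sup>2" by simp_all
    then have "(fst p) ^ 4 \<le> R ^ 4" "(snd p)\<^sup>2 \<le> R ^ 4" using assms(1) by linarith+
    then show "\<bar>fst p\<bar> ^ 4 \<le> R ^ 4" "\<bar>snd p\<bar>\<^sup>2 \<le> (R\<^sup>2)\<^sup>2" by (simp_all flip: power_mult)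
  qed
  then have "\<bar>fst p\<bar> \<le> R" "\<bar>snd p\<bar> \<le> R\<^sup>2"
    using assms(2) power_mono_iff[of "\<bar>fst p\<bar>" R 4] power_mono_iff[of "\<bar>snd p\<bar>" "R\<^sup>2" 2]
    by simp_all
  then show ?thesis
    by (cases p) (auto simp: grushin_box_def abs_le_iff)
qed

text \<open>
  The cutoff is a function of \<open>ln s\<close> for the gauge \<open>s = 1 + x\<^sup>4 + y\<^sup>2\<close>, for which
  \<open>|\<nabla>\<^sub>G ln s|\<^sup>2 \<le> 20 / sqrt s\<close>.
\<close>

lemma logarithmic_cutoff:
  fixes n :: nat
  assumes n: "n > 0"
  obtains \<eta> \<eta>x \<eta>y :: "real \<times> real \<Rightarrow> real" and a b where
    "has_C1_partials \<eta> \<eta>x \<eta>y" "\<And>p. p \<notin> cbox a b \<Longrightarrow> \<eta> p = 0"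
    "\<And>p. 2 * ln (1 + (fst p) ^ 4 + (snd p)\<^sup>2) \<le> n \<Longrightarrow> 1 / 4 \<le> \<eta> p"
    "\<And>p. (\<eta>x p)\<^sup>2 + (fst p)\<^sup>2 * (\<eta>y p)\<^sup>2 \<le>
       (\<Sum>k<n. if p \<in> grushin_box (exp ((real k + 1) / 4)) then 80 / (real n)\<^sup>2 * exp (- real k / 2) else 0)"
proof -
  define s where "s p = 1 + (fst p) ^ 4 + (snd p)\<^sup>2" for p :: "real \<times> real"
  have s1: "s p \<ge> 1" for p using grushin_gauge_bounds(1)[OF s_def] .
  have s: "has_C1_partials s (\<lambda>p. 4 * (fst p) ^ 3) (\<lambda>p. 2 * snd p)"
  proof -
    have "has_C1_partials (\<lambda>p. 1 + (((fst p)\<^sup>2)\<^sup>2 + (snd p)\<^sup>2)) (\<lambda>p. 4 * (fst p) ^ 3) (\<lambda>p. 2 * snd p)"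
      by (rule has_C1_partials_cong[OF has_C1_partials_add[OF has_C1_partials_const has_C1_partials_add[OF
          has_C1_partials_power2[OF has_C1_partials_power2[OF has_C1_partials_fst]]
          has_C1_partials_power2[OF has_C1_partials_snd]]]])
        (auto simp: power2_eq_square power3_eq_cube)
    then show ?thesis by (simp add: s_def[abs_def] add.assoc flip: power_mult)
  qed
  have ln_s: "has_C1_partials (\<lambda>p. ln (s p)) (\<lambda>p. inverse (s p) * (4 * (fst p) ^ 3)) (\<lambda>p. inverse (s p) * (2 * snd p))"
  proof (rule has_C1_partials_compose[OF s])
    have pos: "s p > 0" for p using s1[of p] by linarith
    show "(ln has_real_derivative inverse (s p)) (at (s p))" for p
      using DERIV_ln[OF pos] .
    show "continuous_on UNIV (\<lambda>p. inverse (s p))"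
      using pos by (intro continuous_intros has_C1_partials_continuous[OF s]) (auto simp: less_imp_neq[THEN not_sym])
  qed
  \<comment> \<open>The square makes the cutoff C^1 at t = n; up to t = n / 2 its value is at least
    1 / 4.\<close>
  define g where "g t = (max 0 (1 - t / n))\<^sup>2" for t
  define g' where "g' t = - (2 / n) * max 0 (1 - t / n)" for t :: real
  define \<eta> where "\<eta> p = g (ln (s p))" for p
  define \<eta>x where "\<eta>x p = g' (ln (s p)) * (inverse (s p) * (4 * (fst p) ^ 3))" for p
  define \<eta>y where "\<eta>y p = g' (ln (s p)) * (inverse (s p) * (2 * snd p))" for p
  have g: "(g has_real_derivative g' t) (at t)" for t
    unfolding g_def g'_def
    by (rule DERIV_cong[OF DERIV_chain2[OF DERIV_max_0_squared]])
       (use n in \<open>auto intro!: derivative_eq_intros\<close>)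
  have "has_C1_partials \<eta> \<eta>x \<eta>y"
    unfolding \<eta>_def \<eta>x_def \<eta>y_def
    by (rule has_C1_partials_compose[OF ln_s g])
       (use n in \<open>auto simp: g'_def intro!: continuous_intros has_C1_partials_continuous[OF ln_s]\<close>)
  \<comment> \<open>The gauge has degree 4 under the dilations, so s \<le> exp n puts p into the box
    of size exp (n / 4).\<close>
  moreover have "\<eta> p = 0" if p: "p \<notin> grushin_box (exp (real n / 4))" for p
  proof -
    have "\<not> s p \<le> exp (real n / 4) ^ 4"
      using grushin_box_gauge[of p "exp (real n / 4)"] p by (auto simp: s_def)
    then have "s p > exp n" by (simp flip: exp_of_nat_mult)
    then have "ln (s p) > n" using s1[of p] by (metis ln_exp ln_less_cancel_iff exp_gt_zero less_le_trans zero_less_one)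
    then show ?thesis using n by (simp add: \<eta>_def g_def max_def field_simps)
  qed
  moreover have "1 / 4 \<le> \<eta> p" if "2 * ln (1 + (fst p) ^ 4 + (snd p)\<^sup>2) \<le> n" for p
  proof -
    have "1 / 2 \<le> 1 - ln (s p) / n" using that n by (simp add: s_def field_simps)
    then have "(1 / 2)\<^sup>2 \<le> (max 0 (1 - ln (s p) / n))\<^sup>2"
      by (intro power_mono max.coboundedI2) auto
    then show ?thesis by (simp add: \<eta>_def g_def power2_eq_square)
  qed
  moreover have "(\<eta>x p)\<^sup>2 + (fst p)\<^sup>2 * (\<eta>y p)\<^sup>2 \<le>
     (\<Sum>k<n. if p \<in> grushin_box (exp ((real k + 1) / 4)) then 80 / (real n)\<^sup>2 * exp (- real k / 2) else 0)"
    (is "?l \<le> (\<Sum>k<n. ?r k)") for p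
  proof (cases "ln (s p) < n")
    case False
    then have "g' (ln (s p)) = 0" using n by (simp add: g'_def max_def field_simps)
    then show ?thesis by (auto simp: \<eta>x_def \<eta>y_def intro!: sum_nonneg)
  next
    case True
    have ln0: "ln (s p) \<ge> 0" using s1[of p] by simp
    have sp: "s p > 0" using s1[of p] by linarith
    \<comment> \<open>p lies in the layer k \<le> ln s < k + 1, and the k-th summand alone dominates
      the gradient there. The statement allows whole boxes in place of layers, so that growth bounds
      on boxes apply to it directly.\<close>
    define k where "k = nat \<lfloor>ln (s p)\<rfloor>"
    have k: "real k \<le> ln (s p)" "ln (s p) < real k + 1"
      using ln0 by (auto simp: k_def)
    then have kn: "k < n" using True by linarith
    have "\<bar>1 - ln (s p) / n\<bar> \<le> 1" using ln0 True n by (simp add: field_simps abs_le_iff)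
    then have "(max 0 (1 - ln (s p) / n))\<^sup>2 \<le> 1" by (simp add: abs_square_le_1)
    then have g2: "(g' (ln (s p)))\<^sup>2 \<le> 4 / (real n)\<^sup>2"
      using n by (simp add: g'_def power_mult_distrib power_divide divide_right_mono)
    have "?l = (g' (ln (s p)))\<^sup>2 * ((16 * (fst p) ^ 6 + 4 * (fst p)\<^sup>2 * (snd p)\<^sup>2) / (s p)\<^sup>2)"
      using sp by (simp add: \<eta>x_def \<eta>y_def field_simps power_mult_distrib flip: power_mult)
    \<comment> \<open>The constant 80 is the product of 4, from the slope 2 / n of the cutoff, and
      20, from the gauge.\<close>
    also have "\<dots> \<le> 4 / (real n)\<^sup>2 * (20 / sqrt (s p))"
    proof (rule mult_mono[OF g2])
      have "(16 * (fst p) ^ 6 + 4 * (fst p)\<^sup>2 * (snd p)\<^sup>2) / (s p)\<^sup>2 \<le> (20 * (s p)\<^sup>2 / sqrt (s p)) / (s p)\<^sup>2"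
        by (rule divide_right_mono[OF grushin_gauge_bounds(2)[OF s_def]]) simp
      then show "(16 * (fst p) ^ 6 + 4 * (fst p)\<^sup>2 * (snd p)\<^sup>2) / (s p)\<^sup>2 \<le> 20 / sqrt (s p)"
        using sp by (simp add: field_simps)
    qed auto
    also have "\<dots> \<le> 80 / (real n)\<^sup>2 * exp (- real k / 2)"
    proof -
      have "sqrt (s p) = exp (ln (s p) / 2)"
        using sp by (intro real_sqrt_unique) (auto simp flip: exp_of_nat_mult)
      then have "1 / sqrt (s p) = exp (- (ln (s p) / 2))" by (simp add: exp_minus field_simps)
      also have "\<dots> \<le> exp (- real k / 2)" using k by simp
      finally have "80 / (real n)\<^sup>2 * (1 / sqrt (s p)) \<le> 80 / (real n)\<^sup>2 * exp (- real k / 2)"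
        by (intro mult_left_mono) auto
      then show ?thesis by simp
    qed
    also have "\<dots> = ?r k"
    proof -
      have "s p = exp (ln (s p))" using sp by simp
      also have "\<dots> \<le> exp (real k + 1)" using k by simp
      also have "\<dots> = exp ((real k + 1) / 4) ^ 4" by (simp flip: exp_of_nat_mult)
      finally have "p \<in> grushin_box (exp ((real k + 1) / 4))"
        by (intro grushin_box_gauge) (auto simp: s_def)
      then show ?thesis by simp
    qed
    also have "\<dots> \<le> (\<Sum>k<n. ?r k)"
      using kn by (intro member_le_sum) auto
    finally show ?thesis .
  qed
  ultimately show ?thesis
    using that unfolding grushin_box_def by blast
qed

text \<open>At the k-th scale the decay exp (-k/2) of the squared gradient exactly compensates the
  quadratic growth of the integral of W. Hence each of the n scales contributes O(1/n^2) and the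
  right side of \<open>ineq\<close> is O(1/n), while a positive value of \<kappa> keeps the left
  side away from 0.\<close>

lemma weighted_poincare_liouville:
  fixes W \<kappa> :: "real \<times> real \<Rightarrow> real"
  assumes contW: "continuous_on UNIV W" and W: "\<And>p. W p \<ge> 0"
    and cont\<kappa>: "continuous_on UNIV \<kappa>" and \<kappa>: "\<And>p. \<kappa> p \<ge> 0"
    and growth: "\<And>R. R \<ge> 1 \<Longrightarrow> integral (grushin_box R) W \<le> C * R\<^sup>2"
    and ineq: "\<And>\<eta> \<eta>x \<eta>y a b. has_C1_partials \<eta> \<eta>x \<eta>y \<Longrightarrow> (\<And>p. p \<notin> cbox a b \<Longrightarrow> \<eta> p = 0) \<Longrightarrow>
      integral UNIV (\<lambda>p. 2 * (\<eta> p)\<^sup>2 * \<kappa> p) \<le>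
      integral UNIV (\<lambda>p. W p * ((\<eta>x p)\<^sup>2 + (fst p)\<^sup>2 * (\<eta>y p)\<^sup>2))"
  shows "\<kappa> p = 0"
proof (rule ccontr)
  assume "\<kappa> p \<noteq> 0"
  define \<delta> where "\<delta> = \<kappa> p / 2"
  have \<delta>: "\<delta> > 0" "\<delta> < \<kappa> p" using \<open>\<kappa> p \<noteq> 0\<close> \<kappa>[of p] by (auto simp: \<delta>_def)
  have "open {q. \<delta> < \<kappa> q}"
    by (intro open_Collect_less continuous_intros cont\<kappa>)
  then obtain c d where cd: "cbox c d \<subseteq> {q. \<delta> < \<kappa> q}" "\<forall>i\<in>Basis. c \<bullet> i < d \<bullet> i"
    by (rule open_contains_cbox[of _ p]) (use \<delta> in auto)
  have "continuous_on (cbox c d) (\<lambda>q. ln (1 + (fst q) ^ 4 + (snd q)\<^sup>2))"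
    using grushin_gauge_bounds(1)[OF refl]
    by (intro continuous_intros) (metis less_le_trans not_one_le_zero)
  then have "bounded ((\<lambda>q. ln (1 + (fst q) ^ 4 + (snd q)\<^sup>2)) ` cbox c d)"
    using compact_continuous_image compact_cbox compact_imp_bounded by blast
  then obtain M where M: "\<And>q. q \<in> cbox c d \<Longrightarrow> \<bar>ln (1 + (fst q) ^ 4 + (snd q)\<^sup>2)\<bar> \<le> M"
    unfolding bounded_iff by auto
  have content: "measure lborel (cbox c d) > 0"
    using cd(2) by (simp add: content_pos_lt_eq)
  \<comment> \<open>On the small box \<eta> \<ge> 1/4 and \<kappa> > \<delta>, so the integrand is
    at least 2 * (1/4)^2 * \<delta> = \<delta> / 8.\<close>
  define E where "E = \<delta> / 8 * measure lborel (cbox c d)"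
  have E: "E > 0" using \<delta> content by (simp add: E_def)
  have C: "E \<le> 80 * C * exp (1 / 2) / n" if n: "n > 0" "2 * M \<le> real n" for n :: nat
  proof -
    obtain \<eta> \<eta>x \<eta>y :: "real \<times> real \<Rightarrow> real" and a b where
      \<eta>: "has_C1_partials \<eta> \<eta>x \<eta>y" "\<And>p. p \<notin> cbox a b \<Longrightarrow> \<eta> p = 0" and
      low: "\<And>p. 2 * ln (1 + (fst p) ^ 4 + (snd p)\<^sup>2) \<le> n \<Longrightarrow> 1 / 4 \<le> \<eta> p" and
      up: "\<And>p. (\<eta>x p)\<^sup>2 + (fst p)\<^sup>2 * (\<eta>y p)\<^sup>2 \<le>
       (\<Sum>k<n. if p \<in> grushin_box (exp ((real k + 1) / 4)) then 80 / (real n)\<^sup>2 * exp (- real k / 2) else 0)"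
      by (rule logarithmic_cutoff[OF n(1)]) (rule that; assumption)
    note supp = \<eta>(2) has_C1_partials_support[OF \<eta>(1) closed_cbox \<eta>(2)]
    note cont = has_C1_partials_continuous[OF \<eta>(1)] contW cont\<kappa>
    have int\<kappa>: "(\<lambda>p. 2 * (\<eta> p)\<^sup>2 * \<kappa> p) integrable_on UNIV"
      by (rule integrable_UNIV_support[where a = a and b = b]) (auto simp: supp intro!: continuous_intros cont)
    have intW: "(\<lambda>p. W p * ((\<eta>x p)\<^sup>2 + (fst p)\<^sup>2 * (\<eta>y p)\<^sup>2)) integrable_on UNIV"
      by (rule integrable_UNIV_support[where a = a and b = b]) (auto simp: supp intro!: continuous_intros cont)
    have intB: "(\<lambda>p. if p \<in> grushin_box R then W p else 0) integrable_on UNIV" for R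
      unfolding integrable_restrict_UNIV grushin_box_def
      by (rule integrable_continuous, rule continuous_on_subset[OF contW]) simp
    have "E = integral (cbox c d) (\<lambda>q. \<delta> / 8)"
      by (simp add: E_def)
    also have "\<dots> \<le> integral (cbox c d) (\<lambda>p. 2 * (\<eta> p)\<^sup>2 * \<kappa> p)"
    proof (rule integral_le)
      show "(\<lambda>p. 2 * (\<eta> p)\<^sup>2 * \<kappa> p) integrable_on cbox c d"
        by (rule integrable_on_subcbox[OF int\<kappa>]) simp
      fix q assume q: "q \<in> cbox c d"
      have "1 / 4 \<le> \<eta> q" by (rule low) (use M[OF q] n in linarith)
      then have "(1 / 4)\<^sup>2 \<le> (\<eta> q)\<^sup>2" by (intro power_mono) auto
      then have "(2 * (1 / 4)\<^sup>2) * \<delta> \<le> (2 * (\<eta> q)\<^sup>2) * \<kappa> q"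
        using subsetD[OF cd(1) q] \<delta> by (intro mult_mono) auto
      then show "\<delta> / 8 \<le> 2 * (\<eta> q)\<^sup>2 * \<kappa> q" by (simp add: power2_eq_square)
    qed (auto intro: integrable_continuous)
    also have "\<dots> \<le> integral UNIV (\<lambda>p. 2 * (\<eta> p)\<^sup>2 * \<kappa> p)"
      by (rule integral_subset_le[OF _ integrable_on_subcbox[OF int\<kappa>] int\<kappa>]) (auto simp: \<kappa>)
    also have "\<dots> \<le> integral UNIV (\<lambda>p. W p * ((\<eta>x p)\<^sup>2 + (fst p)\<^sup>2 * (\<eta>y p)\<^sup>2))"
      by (rule ineq[OF \<eta>])
    also have "\<dots> \<le> integral UNIV (\<lambda>p. \<Sum>k<n. 80 / (real n)\<^sup>2 * exp (- real k / 2) *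
        (if p \<in> grushin_box (exp ((real k + 1) / 4)) then W p else 0))"
    proof (rule integral_le[OF intW])
      show "(\<lambda>p. \<Sum>k<n. 80 / (real n)\<^sup>2 * exp (- real k / 2) *
          (if p \<in> grushin_box (exp ((real k + 1) / 4)) then W p else 0)) integrable_on UNIV"
        by (intro integrable_sum integrable_on_mult_right intB) simp
      show "W p * ((\<eta>x p)\<^sup>2 + (fst p)\<^sup>2 * (\<eta>y p)\<^sup>2) \<le> (\<Sum>k<n. 80 / (real n)\<^sup>2 * exp (- real k / 2) *
        (if p \<in> grushin_box (exp ((real k + 1) / 4)) then W p else 0))" for p
        by (rule order_trans[OF mult_left_mono[OF up W]])
           (auto simp: sum_distrib_left mult_ac intro!: sum_mono)
    qed
    also have "\<dots> = (\<Sum>k<n. 80 / (real n)\<^sup>2 * exp (- real k / 2) * integral (grushin_box (exp ((real k + 1) / 4))) W)"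
      by (subst integral_sum) (auto intro!: integrable_on_mult_right intB simp: integral_restrict_UNIV)
    also have "\<dots> \<le> (\<Sum>k<n. 80 / (real n)\<^sup>2 * (C * exp (1 / 2)))"
    proof (rule sum_mono)
      fix k :: nat
      have "integral (grushin_box (exp ((real k + 1) / 4))) W \<le> C * (exp ((real k + 1) / 4))\<^sup>2"
        by (rule growth) simp
      also have "(exp ((real k + 1) / 4))\<^sup>2 = exp (1 / 2) * exp (real k / 2)"
        by (simp add: add_divide_distrib flip: exp_of_nat_mult exp_add)
      finally have "80 / (real n)\<^sup>2 * exp (- real k / 2) * integral (grushin_box (exp ((real k + 1) / 4))) W
          \<le> 80 / (real n)\<^sup>2 * exp (- real k / 2) * (C * (exp (1 / 2) * exp (real k / 2)))"
        by (intro mult_left_mono) auto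
      also have "\<dots> = 80 / (real n)\<^sup>2 * (C * exp (1 / 2)) * (exp (- real k / 2) * exp (real k / 2))"
        by (simp add: field_simps)
      also have "exp (- real k / 2) * exp (real k / 2) = 1" by (simp flip: exp_add)
      finally show "80 / (real n)\<^sup>2 * exp (- real k / 2) * integral (grushin_box (exp ((real k + 1) / 4))) W
          \<le> 80 / (real n)\<^sup>2 * (C * exp (1 / 2))" by simp
    qed
    also have "\<dots> = 80 * C * exp (1 / 2) / n"
      using n by (simp add: power2_eq_square field_simps)
    finally show ?thesis .
  qed
  obtain n :: nat where n: "real n > max (2 * M) (max 1 (80 * C * exp (1 / 2) / E))"
    using reals_Archimedean2 by blast
  then have "E \<le> 80 * C * exp (1 / 2) / n" by (intro C) auto
  moreover have "80 * C * exp (1 / 2) / E < n" using n by simp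
  ultimately show False using E n by (simp add: field_simps)
qed

section \<open>The weighted Poincare inequality\<close>

context grushin_minimizer
begin

text \<open>Subtract the equation for \<open>ux\<close>, tested with \<eta>^2 ux, from the second
  variation at \<eta> ux. The Hessian of H and the second derivatives of u cancel, up to the
  commutator term - 2 x uy \<bullet> \<zeta>y.\<close>

lemma test_inequality_x:
  assumes \<eta>: "has_C1_partials \<eta> \<eta>x \<eta>y" and supp: "\<And>p. p \<notin> cbox a b \<Longrightarrow> \<eta> p = 0"
  shows "0 \<le> integral UNIV (\<lambda>p. (ux p \<bullet> ux p) * ((\<eta>x p)\<^sup>2 + (fst p)\<^sup>2 * (\<eta>y p)\<^sup>2) +
           2 * (\<eta> p)\<^sup>2 * fst p * (uyy p \<bullet> ux p))"
proof -
  note supp' = supp has_C1_partials_support[OF \<eta> closed_cbox supp]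
  note cont = cont_u has_C1_partials_continuous[OF \<eta>] continuous_on_compose2[OF cont_d2H]
  note phi = has_C1_partials_scaleR[OF \<eta> ux]
  define \<zeta> where "\<zeta> p = (\<eta> p)\<^sup>2 *\<^sub>R ux p" for p
  define \<zeta>x where "\<zeta>x p = (2 * \<eta> p * \<eta>x p) *\<^sub>R ux p + (\<eta> p)\<^sup>2 *\<^sub>R uxx p" for p
  define \<zeta>y where "\<zeta>y p = (2 * \<eta> p * \<eta>y p) *\<^sub>R ux p + (\<eta> p)\<^sup>2 *\<^sub>R uxy p" for p
  have \<zeta>: "has_C1_partials \<zeta> \<zeta>x \<zeta>y"
    unfolding \<zeta>_def \<zeta>x_def \<zeta>y_def
    by (rule has_C1_partials_scaleR[OF has_C1_partials_power2[OF \<eta>] ux])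
  define S where "S p = (\<eta>x p *\<^sub>R ux p + \<eta> p *\<^sub>R uxx p) \<bullet> (\<eta>x p *\<^sub>R ux p + \<eta> p *\<^sub>R uxx p) +
    (fst p)\<^sup>2 * ((\<eta>y p *\<^sub>R ux p + \<eta> p *\<^sub>R uxy p) \<bullet> (\<eta>y p *\<^sub>R ux p + \<eta> p *\<^sub>R uxy p)) +
    d2H (u p) (\<eta> p *\<^sub>R ux p) (\<eta> p *\<^sub>R ux p)" for p
  define L where "L p = uxx p \<bullet> \<zeta>x p + (2 * fst p) * (uy p \<bullet> \<zeta>y p) + (fst p)\<^sup>2 * (uxy p \<bullet> \<zeta>y p) +
           d2H (u p) (ux p) (\<zeta> p)" for p
  \<comment> \<open>\<open>I\<close> is the y-partial of x (uy \<bullet> \<zeta>). Adding it twice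
    moves the y-derivative in the commutator term from \<zeta> to \<open>uy\<close>.\<close>
  define I where "I p = fst p * (uyy p \<bullet> \<zeta> p) + fst p * (uy p \<bullet> \<zeta>y p)" for p
  have S: "integral UNIV S \<ge> 0"
    using second_variation[OF phi, of a b] supp by (simp add: S_def[abs_def] add.commute)
  have L: "integral UNIV L = 0"
    using linearized_equation(1)[OF \<zeta>, of a b] supp by (simp add: L_def[abs_def] \<zeta>_def)
  have I: "integral UNIV I = 0"
    using integral_partials_eq_0(2)[OF has_C1_partials_mult[OF has_C1_partials_fst
        has_C1_partials_inner[OF uy \<zeta>]], of a b] supp
    by (simp add: I_def[abs_def] \<zeta>_def algebra_simps)
  have int: "S integrable_on UNIV" "L integrable_on UNIV" "I integrable_on UNIV"
    by (rule integrable_UNIV_support[where a = a and b = b],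
        auto simp: S_def[abs_def] L_def[abs_def] I_def[abs_def] \<zeta>_def \<zeta>x_def \<zeta>y_def supp'
          intro!: continuous_intros cont)+
  have "(ux p \<bullet> ux p) * ((\<eta>x p)\<^sup>2 + (fst p)\<^sup>2 * (\<eta>y p)\<^sup>2) + 2 * (\<eta> p)\<^sup>2 * fst p * (uyy p \<bullet> ux p)
      = S p - L p + I p + I p" for p
    unfolding S_def L_def I_def \<zeta>_def \<zeta>x_def \<zeta>y_def
    by (simp add: inner_add_left inner_add_right blinfun.scaleR_left blinfun.scaleR_right inner_commute
        power2_eq_square algebra_simps)
  then have "integral UNIV (\<lambda>p. (ux p \<bullet> ux p) * ((\<eta>x p)\<^sup>2 + (fst p)\<^sup>2 * (\<eta>y p)\<^sup>2) +
           2 * (\<eta> p)\<^sup>2 * fst p * (uyy p \<bullet> ux p)) = integral UNIV S - integral UNIV L + integral UNIV I + integral UNIV I"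
    using int by (simp add: integral_add integral_diff integrable_diff integrable_add)
  then show ?thesis using S L I by simp
qed

text \<open>Here \<eta> Y u is written as \<xi> uy with \<xi> = x \<eta>, because the equation for
  \<open>uy\<close> has no commutator term. The price is the summand \<eta> in
  \<open>\<xi>x\<close>; its contribution is removed by integrating the x-partial \<open>I\<close>
  of x \<eta>^2 (uy \<bullet> uy).\<close>

lemma test_inequality_y:
  assumes \<eta>: "has_C1_partials \<eta> \<eta>x \<eta>y" and supp: "\<And>p. p \<notin> cbox a b \<Longrightarrow> \<eta> p = 0"
  shows "0 \<le> integral UNIV (\<lambda>p. (fst p)\<^sup>2 * (uy p \<bullet> uy p) * ((\<eta>x p)\<^sup>2 + (fst p)\<^sup>2 * (\<eta>y p)\<^sup>2) -
           2 * (\<eta> p)\<^sup>2 * fst p * (uxy p \<bullet> uy p))"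
proof -
  note supp' = supp has_C1_partials_support[OF \<eta> closed_cbox supp]
  note cont = cont_u has_C1_partials_continuous[OF \<eta>] continuous_on_compose2[OF cont_d2H]
  define \<xi> where "\<xi> p = fst p * \<eta> p" for p
  define \<xi>x where "\<xi>x p = \<eta> p + fst p * \<eta>x p" for p
  define \<xi>y where "\<xi>y p = fst p * \<eta>y p" for p
  have \<xi>: "has_C1_partials \<xi> \<xi>x \<xi>y"
    unfolding \<xi>_def
    by (rule has_C1_partials_cong[OF has_C1_partials_mult[OF has_C1_partials_fst \<eta>]])
       (auto simp: \<xi>x_def \<xi>y_def)
  note phi = has_C1_partials_scaleR[OF \<xi> uy]
  define \<zeta> where "\<zeta> p = (\<xi> p)\<^sup>2 *\<^sub>R uy p" for p
  define \<zeta>x where "\<zeta>x p = (2 * \<xi> p * \<xi>x p) *\<^sub>R uy p + (\<xi> p)\<^sup>2 *\<^sub>R uxy p" for p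
  define \<zeta>y where "\<zeta>y p = (2 * \<xi> p * \<xi>y p) *\<^sub>R uy p + (\<xi> p)\<^sup>2 *\<^sub>R uyy p" for p
  have \<zeta>: "has_C1_partials \<zeta> \<zeta>x \<zeta>y"
    unfolding \<zeta>_def \<zeta>x_def \<zeta>y_def
    by (rule has_C1_partials_scaleR[OF has_C1_partials_power2[OF \<xi>] uy])
  define S where "S p = (\<xi>x p *\<^sub>R uy p + \<xi> p *\<^sub>R uxy p) \<bullet> (\<xi>x p *\<^sub>R uy p + \<xi> p *\<^sub>R uxy p) +
    (fst p)\<^sup>2 * ((\<xi>y p *\<^sub>R uy p + \<xi> p *\<^sub>R uyy p) \<bullet> (\<xi>y p *\<^sub>R uy p + \<xi> p *\<^sub>R uyy p)) +
    d2H (u p) (\<xi> p *\<^sub>R uy p) (\<xi> p *\<^sub>R uy p)" for p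
  define L where "L p = uxy p \<bullet> \<zeta>x p + (fst p)\<^sup>2 * (uyy p \<bullet> \<zeta>y p) + d2H (u p) (uy p) (\<zeta> p)" for p
  define I where "I p = (\<eta> p)\<^sup>2 * (uy p \<bullet> uy p) + 2 * fst p * \<eta> p * \<eta>x p * (uy p \<bullet> uy p) +
    2 * fst p * (\<eta> p)\<^sup>2 * (uy p \<bullet> uxy p)" for p
  have S: "integral UNIV S \<ge> 0"
    using second_variation[OF phi, of a b] supp by (simp add: S_def[abs_def] \<xi>_def add.commute)
  have L: "integral UNIV L = 0"
    using linearized_equation(2)[OF \<zeta>, of a b] supp by (simp add: L_def[abs_def] \<zeta>_def \<xi>_def)
  have I: "integral UNIV I = 0"
    using integral_partials_eq_0(1)[OF has_C1_partials_mult[OF \<eta> has_C1_partials_mult[OF \<xi>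
        has_C1_partials_inner[OF uy uy]]], of a b] supp
    by (simp add: I_def[abs_def] \<xi>_def \<xi>x_def algebra_simps inner_commute power2_eq_square)
  have int: "S integrable_on UNIV" "L integrable_on UNIV" "I integrable_on UNIV"
    by (rule integrable_UNIV_support[where a = a and b = b],
        auto simp: S_def[abs_def] L_def[abs_def] I_def[abs_def] \<zeta>_def \<zeta>x_def \<zeta>y_def \<xi>_def \<xi>x_def \<xi>y_def supp'
          intro!: continuous_intros cont)+
  have "(fst p)\<^sup>2 * (uy p \<bullet> uy p) * ((\<eta>x p)\<^sup>2 + (fst p)\<^sup>2 * (\<eta>y p)\<^sup>2) - 2 * (\<eta> p)\<^sup>2 * fst p * (uxy p \<bullet> uy p)
      = S p - L p - I p" for p
    unfolding S_def L_def I_def \<zeta>_def \<zeta>x_def \<zeta>y_def \<xi>_def \<xi>x_def \<xi>y_def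
    by (simp add: inner_add_left inner_add_right blinfun.scaleR_left blinfun.scaleR_right inner_commute
        power2_eq_square algebra_simps)
  then have "integral UNIV (\<lambda>p. (fst p)\<^sup>2 * (uy p \<bullet> uy p) * ((\<eta>x p)\<^sup>2 + (fst p)\<^sup>2 * (\<eta>y p)\<^sup>2) -
           2 * (\<eta> p)\<^sup>2 * fst p * (uxy p \<bullet> uy p)) = integral UNIV S - integral UNIV L - integral UNIV I"
    using int by (simp add: integral_diff integrable_diff)
  then show ?thesis using S L I by simp
qed

definition grad_sq :: "real \<times> real \<Rightarrow> real" where
  "grad_sq p = ux p \<bullet> ux p + (fst p)\<^sup>2 * (uy p \<bullet> uy p)"

text \<open>In ordinary partials this is the sum over i of ZYu_i Xu_i - ZXu_i Yu_i, so the sign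
  hypothesis makes it nonpositive.\<close>

definition curvature :: "real \<times> real \<Rightarrow> real" where
  "curvature p = fst p * (uyy p \<bullet> ux p - uxy p \<bullet> uy p)"

lemma cont_grad_sq: "continuous_on S grad_sq"
  unfolding grad_sq_def[abs_def] by (intro continuous_intros cont_u)

lemma cont_curvature: "continuous_on S curvature"
  unfolding curvature_def[abs_def] by (intro continuous_intros cont_u)

lemma weighted_poincare:
  assumes \<eta>: "has_C1_partials \<eta> \<eta>x \<eta>y" and supp: "\<And>p. p \<notin> cbox a b \<Longrightarrow> \<eta> p = 0"
  shows "integral UNIV (\<lambda>p. 2 * (\<eta> p)\<^sup>2 * - curvature p) \<le>
    integral UNIV (\<lambda>p. grad_sq p * ((\<eta>x p)\<^sup>2 + (fst p)\<^sup>2 * (\<eta>y p)\<^sup>2))"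
proof -
  note supp' = supp has_C1_partials_support[OF \<eta> closed_cbox supp]
  note cont = cont_u has_C1_partials_continuous[OF \<eta>] cont_grad_sq cont_curvature
  define A where "A p = (ux p \<bullet> ux p) * ((\<eta>x p)\<^sup>2 + (fst p)\<^sup>2 * (\<eta>y p)\<^sup>2) +
           2 * (\<eta> p)\<^sup>2 * fst p * (uyy p \<bullet> ux p)" for p
  define B where "B p = (fst p)\<^sup>2 * (uy p \<bullet> uy p) * ((\<eta>x p)\<^sup>2 + (fst p)\<^sup>2 * (\<eta>y p)\<^sup>2) -
           2 * (\<eta> p)\<^sup>2 * fst p * (uxy p \<bullet> uy p)" for p
  define C where "C p = 2 * (\<eta> p)\<^sup>2 * - curvature p" for p
  have int: "A integrable_on UNIV" "B integrable_on UNIV" "C integrable_on UNIV"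
    by (rule integrable_UNIV_support[where a = a and b = b],
        auto simp: A_def[abs_def] B_def[abs_def] C_def[abs_def] supp' intro!: continuous_intros cont)+
  have "integral UNIV (\<lambda>p. A p + B p + C p) = integral UNIV A + integral UNIV B + integral UNIV C"
    using int by (simp add: integral_add integrable_add)
  moreover have "A p + B p + C p = grad_sq p * ((\<eta>x p)\<^sup>2 + (fst p)\<^sup>2 * (\<eta>y p)\<^sup>2)" for p
    by (simp add: A_def B_def C_def grad_sq_def curvature_def algebra_simps)
  ultimately show ?thesis
    using test_inequality_x[OF assms] test_inequality_y[OF assms]
    by (simp add: A_def[abs_def] B_def[abs_def] C_def[abs_def])
qed

end

section \<open>Functions whose gradient direction depends only on x\<close>

text \<open>To be instantiated with one component of u once its curvature term is known to vanish.
  By \<open>nonzero\<close> the Euclidean gradient vanishes nowhere, the line x = 0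
  included.\<close>

locale parallel_gradient =
  fixes w wx wy wxx wxy wyy :: "real \<times> real \<Rightarrow> real"
  assumes w: "has_C1_partials w wx wy"
    and wx: "has_C1_partials wx wxx wxy"
    and wy: "has_C1_partials wy wxy wyy"
    and nonzero: "\<And>p. wx p \<noteq> 0 \<or> fst p * wy p \<noteq> 0"
    and parallel: "\<And>p. fst p * (wyy p * wx p - wxy p * wy p) = 0"
begin

text \<open>On the line x = 0 the factor \<open>fst p\<close> hides the identity; it is recovered as
  a limit from x > 0.\<close>

lemma parallel': "wyy p * wx p = wxy p * wy p"
proof (cases "fst p = 0")
  case True
  define E where "E q = wyy q * wx q - wxy q * wy q" for q
  define X where "X n = (inverse (real (Suc n)), snd p)" for n
  have "X \<longlonglongrightarrow> (0, snd p)"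
    unfolding X_def by (intro tendsto_Pair LIMSEQ_inverse_real_of_nat tendsto_const)
  then have "X \<longlonglongrightarrow> p" using True by (metis prod.collapse)
  moreover have "continuous_on UNIV E"
    unfolding E_def
    by (intro continuous_intros has_C1_partials_continuous[OF wx] has_C1_partials_continuous[OF wy])
  then have "isCont E p" by (metis UNIV_I continuous_on_eq_continuous_at open_UNIV)
  ultimately have "(\<lambda>n. E (X n)) \<longlonglongrightarrow> E p" by (rule isCont_tendsto_compose[rotated])
  moreover have "E (X n) = 0" for n using parallel[of "X n"] by (simp add: X_def E_def)
  ultimately have "E p = 0" by (simp add: LIMSEQ_const_iff)
  then show ?thesis by (simp add: E_def)
next
  case False
  then show ?thesis using parallel[of p] by simp
qed

text \<open>The y-derivative of the gradient is parallel to the gradient, so the direction is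
  constant along a vertical line. \<open>(D t)\<^sup>2 / N t\<close> is, up to the factor a^2 + b^2,
  the squared sine of the angle between the gradients at heights t and z. Its derivative contains
  the factor killed by \<open>parallel'\<close>, and it is 0 at t = z.\<close>

lemma cross_eq_0: "wx (x, y) * wy (x, z) = wy (x, y) * wx (x, z)"
proof -
  define a b where "a = wx (x, z)" and "b = wy (x, z)"
  define D where "D t = wx (x, t) * b - wy (x, t) * a" for t
  define N where "N t = (wx (x, t))\<^sup>2 + (wy (x, t))\<^sup>2" for t
  have N: "N t > 0" for t
    using nonzero[of "(x, t)"] by (auto simp: N_def sum_power2_gt_zero_iff)
  have DD: "(D has_real_derivative wxy (x, t) * b - wyy (x, t) * a) (at t)" (is "(D has_real_derivative ?D' t) _") for t
    unfolding D_def
    by (auto intro!: derivative_eq_intros has_C1_partials_real(2)[OF wx] has_C1_partials_real(2)[OF wy])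
  have DN: "(N has_real_derivative 2 * (wx (x, t) * wxy (x, t) + wy (x, t) * wyy (x, t))) (at t)"
      (is "(N has_real_derivative 2 * ?N' t) _") for t
    unfolding N_def
    by (auto intro!: derivative_eq_intros has_C1_partials_real(2)[OF wx] has_C1_partials_real(2)[OF wy])
  have "((\<lambda>t. (D t)\<^sup>2 / N t) has_real_derivative 0) (at t)" for t
  proof -
    have "?D' t * N t - D t * ?N' t =
        (a * wx (x, t) + b * wy (x, t)) * (wxy (x, t) * wy (x, t) - wyy (x, t) * wx (x, t))"
      by (simp add: D_def N_def power2_eq_square algebra_simps)
    then have 0: "?D' t * N t = D t * ?N' t" using parallel'[of "(x, t)"] by simp
    have "((\<lambda>t. (D t)\<^sup>2 / N t) has_real_derivative
        (2 * D t * ?D' t * N t - (D t)\<^sup>2 * (2 * ?N' t)) / (N t * N t)) (at t)"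
      using N[of t] by (auto intro!: derivative_eq_intros DD DN)
    moreover have "2 * D t * ?D' t * N t - (D t)\<^sup>2 * (2 * ?N' t) = 2 * D t * (?D' t * N t - D t * ?N' t)"
      by (simp add: power2_eq_square algebra_simps)
    ultimately show ?thesis using 0 by simp
  qed
  then have "(D y)\<^sup>2 / N y = (D z)\<^sup>2 / N z" by (intro DERIV_isconst_all) auto
  also have "D z = 0" by (simp add: D_def a_def b_def)
  finally show ?thesis using N[of y] by (simp add: D_def a_def b_def)
qed

text \<open>At (x, z) the gradient is then horizontal with \<open>wx\<close> nonzero, and all
  gradients on the vertical line are parallel to it.\<close>

lemma wy_eq_0: "wy (x, z) = 0 \<Longrightarrow> wy (x, y) = 0"
  using cross_eq_0[of x y z] nonzero[of "(x, z)"] by auto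

text \<open>By \<open>cross_eq_0\<close> the ratio \<tau> = wx / wy depends on x only, so w solves
  the transport equation wx = \<tau>(x) wy. With T a primitive of \<tau>, the characteristics are
  the vertical translates of the graph of - T. Hence the profile at x1 is a vertical translate of
  the profile at x0.\<close>

lemma transport:
  assumes x: "x0 \<le> x1" and ne: "\<And>x. x0 \<le> x \<Longrightarrow> x \<le> x1 \<Longrightarrow> wy (x, 0) \<noteq> 0"
  obtains c where "\<And>y. w (x1, y - c) = w (x0, y)" "\<And>y. wy (x1, y - c) = wy (x0, y)"
proof -
  define \<tau> where "\<tau> x = wx (x, 0) / wy (x, 0)" for x
  have "continuous_on {x0..x1} \<tau>"
    unfolding \<tau>_def using ne
    by (intro continuous_intros continuous_on_compose2[OF has_C1_partials_continuous(2)[OF w, of UNIV]]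
          continuous_on_compose2[OF has_C1_partials_continuous(3)[OF w, of UNIV]]) auto
  then obtain T where T: "\<And>x. x \<in> {x0..x1} \<Longrightarrow> (T has_vector_derivative \<tau> x) (at x within {x0..x1})"
    by (rule antiderivative_continuous) (rule that)
  define c where "c = T x1 - T x0"
  have *: "w (x1, y - c) = w (x0, y)" for y
  proof -
    define k where "k x = w (x, y - (T x - T x0))" for x
    have "(k has_real_derivative 0) (at x within {x0..x1})" if xx: "x \<in> {x0..x1}" for x
    proof -
      have "wy (x, 0) \<noteq> 0" using ne xx by simp
      then have slope: "wx (x, y - (T x - T x0)) = \<tau> x * wy (x, y - (T x - T x0))"
        using cross_eq_0[of x "y - (T x - T x0)" 0] by (simp add: \<tau>_def field_simps)
      have "((\<lambda>x. (x, y - (T x - T x0))) has_derivative (\<lambda>h. (h, - (h * \<tau> x)))) (at x within {x0..x1})"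
        using T[OF xx] unfolding has_vector_derivative_def
        by (auto intro!: derivative_eq_intros)
      from has_derivative_compose[OF this has_C1_partials_derivative[OF w]]
      have "(k has_derivative (\<lambda>h. h * wx (x, y - (T x - T x0)) + - (h * \<tau> x) * wy (x, y - (T x - T x0))))
          (at x within {x0..x1})"
        unfolding k_def by simp
      also have "(\<lambda>h. h * wx (x, y - (T x - T x0)) + - (h * \<tau> x) * wy (x, y - (T x - T x0))) = (\<lambda>h. 0)"
        unfolding slope by simp
      finally show ?thesis
        by (simp add: has_field_derivative_def lambda_zero)
    qed
    then obtain C where "\<And>x. x \<in> {x0..x1} \<Longrightarrow> k x = C"
      using has_field_derivative_zero_constant[of "{x0..x1}" k] by auto
    then have "k x1 = k x0" using x by simp
    then show ?thesis by (simp add: k_def c_def)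
  qed
  have "wy (x1, y - c) = wy (x0, y)" for y
  proof (rule DERIV_unique)
    show "((\<lambda>t. w (x0, t)) has_real_derivative wy (x0, y)) (at y)"
      by (rule has_C1_partials_real[OF w])
    have "((\<lambda>t. w (x1, t - c)) has_real_derivative wy (x1, y - c)) (at y)"
      using DERIV_shift[of "\<lambda>t. w (x1, t)" "wy (x1, y - c)" y "- c"] has_C1_partials_real(2)[OF w, of x1 "y - c"]
      by simp
    then show "((\<lambda>t. w (x0, t)) has_real_derivative wy (x1, y - c)) (at y)"
      by (simp add: *)
  qed
  with * show thesis by (rule that)
qed

text \<open>
  Where \<open>wy \<noteq> 0\<close> the function is transported rigidly in the \<open>y\<close> direction along characteristics.
  Either this happens for arbitrarily large \<open>x\<close>, against the bound on \<open>x * wy\<close>,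
  or it happens up to a line on which \<open>w\<close> is constant, against the bound on \<open>wx\<close>.
\<close>

lemma independent_of_y:
  assumes Mx: "\<And>p. \<bar>wx p\<bar> \<le> M" and My: "\<And>p. \<bar>fst p * wy p\<bar> \<le> M"
  shows "\<exists>g. \<forall>x y. w (x, y) = g x"
proof -
  have "wy (x0, y0) = 0" for x0 y0
  proof (rule ccontr)
    assume "wy (x0, y0) \<noteq> 0"
    then have ne0: "wy (x0, y) \<noteq> 0" for y using wy_eq_0 by blast
    have M0: "M \<ge> 0" using Mx[of undefined] by linarith
    show False
    proof (cases "\<exists>x\<ge>x0. wy (x, 0) = 0")
      case False
      define d where "d = \<bar>wy (x0, 0)\<bar>"
      have d: "d > 0" using ne0 by (simp add: d_def)
      \<comment> \<open>Transport carries the value of \<open>wy\<close> at (x0, 0) unchanged to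
        some point with abscissa x1, which is chosen to make x1 * d exceed M.\<close>
      define x1 where "x1 = max x0 (M / d + 1)"
      obtain c where c: "\<And>y. wy (x1, y - c) = wy (x0, y)"
        using False by (rule_tac transport[of x0 x1]) (auto simp: x1_def)
      have "\<bar>x1\<bar> * d \<le> M"
        using My[of "(x1, 0 - c)"] unfolding fst_conv c by (simp add: abs_mult d_def)
      moreover have "x1 > M / d" "x1 > 0" using M0 d by (auto simp: x1_def less_max_iff_disj add_nonneg_pos)
      then have "\<bar>x1\<bar> * d > M" using d by (simp add: field_simps)
      ultimately show False by simp
    next
      case True
      \<comment> \<open>By \<open>wy_eq_0\<close> the height 0 represents the whole vertical line;
        the infimum of \<open>Z\<close> is the first line to the right of x0 on which
        \<open>wy\<close> vanishes.\<close>
      define Z where "Z = {x. x0 \<le> x \<and> wy (x, 0) = 0}"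
      have "closed Z"
        unfolding Z_def
        by (intro closed_Collect_conj closed_Collect_le closed_Collect_eq continuous_intros
            continuous_on_compose2[OF has_C1_partials_continuous(3)[OF w, of UNIV]]) auto
      moreover have "Z \<noteq> {}" "bdd_below Z" using True by (auto simp: Z_def intro!: bdd_belowI[of _ x0])
      ultimately have "Inf Z \<in> Z" by (intro closed_contains_Inf)
      define x1 where "x1 = Inf Z"
      have x1: "x0 \<le> x1" "wy (x1, 0) = 0"
        using \<open>Inf Z \<in> Z\<close> by (auto simp: Z_def x1_def)
      then have "x0 < x1" using ne0[of 0] by (cases "x0 = x1") auto
      have before: "wy (x, 0) \<noteq> 0" if "x0 \<le> x" "x < x1" for x
        using that cInf_lower[of x Z] \<open>bdd_below Z\<close> by (auto simp: Z_def x1_def)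
      have const: "w (x1, y) = w (x1, z)" for y z
        by (rule DERIV_isconst_all)
           (use wy_eq_0[OF x1(2)] has_C1_partials_real(2)[OF w, of x1] in auto)
      have near: "\<bar>w (x1, y) - w (x, y)\<bar> \<le> M * (x1 - x)" if "x < x1" for x y
      proof -
        have "\<exists>z. x < z \<and> z < x1 \<and> w (x1, y) - w (x, y) = (x1 - x) * wx (z, y)"
          by (rule MVT2) (use that in \<open>auto intro!: has_C1_partials_real[OF w]\<close>)
        then obtain z where "w (x1, y) - w (x, y) = (x1 - x) * wx (z, y)" by auto
        then show ?thesis
          using that Mx[of "(z, y)"] by (simp add: abs_mult mult.commute mult_left_mono)
      qed
      \<comment> \<open>Transport finds the same difference of two values of w on every line between
        x0 and x1. Near x1 all values are within M * (x1 - x) of one constant, so the difference is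
        0, and the mean value theorem produces a zero of \<open>wy\<close> on the line x0.\<close>
      define \<delta> where "\<delta> = \<bar>w (x0, 0) - w (x0, 1)\<bar>"
      have le: "\<delta> \<le> 2 * M * (x1 - x)" if x: "x0 \<le> x" "x < x1" for x
      proof -
        obtain c where c: "\<And>y. w (x, y - c) = w (x0, y)"
          using before x by (rule_tac transport[of x0 x]) auto
        have "\<delta> = \<bar>w (x, 0 - c) - w (x, 1 - c)\<bar>" by (simp only: \<delta>_def c)
        also have "\<dots> \<le> 2 * M * (x1 - x)"
          using near[OF x(2), of "0 - c"] near[OF x(2), of "1 - c"] const[of "0 - c" "1 - c"] by linarith
        finally show ?thesis .
      qed
      have "\<delta> \<le> 0"
      proof (rule tendsto_lowerbound)
        show "((\<lambda>x. 2 * M * (x1 - x)) \<longlongrightarrow> 0) (at_left x1)"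
          by (auto intro!: tendsto_eq_intros)
        show "\<forall>\<^sub>F x in at_left x1. \<delta> \<le> 2 * M * (x1 - x)"
          using eventually_at_left_real[OF \<open>x0 < x1\<close>] by eventually_elim (auto intro!: le)
      qed simp
      then have "w (x0, 1) = w (x0, 0)" by (simp add: \<delta>_def)
      moreover have "\<exists>z. 0 < z \<and> z < 1 \<and> w (x0, 1) - w (x0, 0) = (1 - 0) * wy (x0, z)"
        by (rule MVT2) (auto intro!: has_C1_partials_real[OF w])
      ultimately show False using ne0 by auto
    qed
  qed
  then have "w (x, y) = w (x, 0)" for x y
    using DERIV_isconst_all[of "\<lambda>t. w (x, t)" y 0] has_C1_partials_real(2)[OF w, of x] by auto
  then show ?thesis by (intro exI[of _ "\<lambda>x. w (x, 0)"]) simp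
qed

end

section \<open>Energy growth\<close>

lemma smooth_step:
  obtains q q' :: "real \<Rightarrow> real" where
    "\<And>t. (q has_real_derivative q' t) (at t)" "continuous_on UNIV q'"
    "\<And>t. 0 \<le> q t" "\<And>t. q t \<le> 1" "\<And>t. \<bar>q' t\<bar> \<le> 4"
    "\<And>t. t \<le> 0 \<Longrightarrow> q t = 1" "\<And>t. t \<le> 0 \<Longrightarrow> q' t = 0" "\<And>t. t \<ge> 1 \<Longrightarrow> q t = 0"
proof
  \<comment> \<open>The inner square makes the step C^1 at 0, the outer one at 1.\<close>
  let ?q = "\<lambda>t::real. (max 0 (1 - (max 0 t)\<^sup>2))\<^sup>2"
  let ?q' = "\<lambda>t::real. 2 * max 0 (1 - (max 0 t)\<^sup>2) * - (2 * max 0 t)"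
  show "(?q has_real_derivative ?q' t) (at t)" for t
    by (rule DERIV_chain2[OF DERIV_max_0_squared])
       (rule derivative_eq_intros DERIV_max_0_squared | simp)+
  show "continuous_on UNIV ?q'" by (intro continuous_intros)
  have one: "max 0 (1 - (max 0 t)\<^sup>2) \<le> 1" for t :: real by simp
  show "0 \<le> ?q t" for t by simp
  show "?q t \<le> 1" for t using one[of t] by (simp add: power_le_one)
  show "\<bar>?q' t\<bar> \<le> 4" for t
  proof (cases "t \<le> 1")
    case True
    then have "max 0 (1 - (max 0 t)\<^sup>2) * max 0 t \<le> 1 * 1"
      by (intro mult_mono one) auto
    then show ?thesis by (simp add: abs_mult)
  next
    case False
    then have "(max 0 t)\<^sup>2 \<ge> 1" by (simp add: one_le_power)
    then show ?thesis by simp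
  qed
  show "?q t = 1" "?q' t = 0" if "t \<le> 0" for t using that by simp_all
  show "?q t = 0" if "t \<ge> 1" for t
  proof -
    have "(max 0 t)\<^sup>2 \<ge> 1" using that by (simp add: one_le_power)
    then show ?thesis by simp
  qed
qed

text \<open>A product of two steps, one for each end of the interval; each contributes 4 / S to the
  slope bound.\<close>

lemma plateau:
  fixes R S :: real
  assumes S: "S > 0"
  obtains f f' :: "real \<Rightarrow> real" where
    "\<And>t. (f has_real_derivative f' t) (at t)" "continuous_on UNIV f'"
    "\<And>t. 0 \<le> f t" "\<And>t. f t \<le> 1" "\<And>t. \<bar>f' t\<bar> \<le> 8 / S"
    "\<And>t. \<bar>t\<bar> \<le> R \<Longrightarrow> f t = 1" "\<And>t. \<bar>t\<bar> \<le> R \<Longrightarrow> f' t = 0" "\<And>t. \<bar>t\<bar> \<ge> R + S \<Longrightarrow> f t = 0"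
proof -
  obtain q q' :: "real \<Rightarrow> real" where q: "\<And>t. (q has_real_derivative q' t) (at t)" "continuous_on UNIV q'"
    "\<And>t. 0 \<le> q t" "\<And>t. q t \<le> 1" "\<And>t. \<bar>q' t\<bar> \<le> 4"
    "\<And>t. t \<le> 0 \<Longrightarrow> q t = 1" "\<And>t. t \<le> 0 \<Longrightarrow> q' t = 0" "\<And>t. t \<ge> 1 \<Longrightarrow> q t = 0"
    by (rule smooth_step) (rule that; assumption)
  have cont: "continuous_on T q" for T
    using q(1) by (meson DERIV_isCont continuous_at_imp_continuous_on)
  define a where "a t = (t - R) / S" for t
  define b where "b t = (- t - R) / S" for t
  define f where "f t = q (a t) * q (b t)" for t
  define f' where "f' t = (1 / S) * (q' (a t) * q (b t)) - (1 / S) * (q (a t) * q' (b t))" for t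
  show thesis
  proof (rule that)
    show "(f has_real_derivative f' t) (at t)" for t
    proof -
      have a: "(a has_real_derivative 1 / S) (at t)" and b: "(b has_real_derivative - 1 / S) (at t)"
        unfolding a_def b_def using S by (auto intro!: derivative_eq_intros)
      show ?thesis
        unfolding f_def f'_def
        by (rule DERIV_cong[OF DERIV_mult[OF DERIV_chain2[OF q(1) a] DERIV_chain2[OF q(1) b]]]) simp
    qed
    show "continuous_on UNIV f'"
      unfolding f'_def a_def b_def
      using S by (auto intro!: continuous_intros continuous_on_compose2[OF q(2)] continuous_on_compose2[OF cont])
    show "0 \<le> f t" "f t \<le> 1" for t
      by (auto simp: f_def q mult_le_one)
    show "\<bar>f' t\<bar> \<le> 8 / S" for t
    proof -
      have "\<bar>q' (a t) * q (b t)\<bar> \<le> 4 * 1" "\<bar>q (a t) * q' (b t)\<bar> \<le> 1 * 4"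
        unfolding abs_mult by (intro mult_mono; simp add: q)+
      then have "\<bar>q' (a t) * q (b t) - q (a t) * q' (b t)\<bar> \<le> 8" by linarith
      then have "\<bar>q' (a t) * q (b t) - q (a t) * q' (b t)\<bar> / S \<le> 8 / S"
        using S by (simp add: divide_right_mono)
      moreover have "f' t = (q' (a t) * q (b t) - q (a t) * q' (b t)) / S"
        by (simp add: f'_def diff_divide_distrib)
      ultimately show ?thesis using S by (simp add: abs_divide)
    qed
    show "f t = 1" "f' t = 0" if "\<bar>t\<bar> \<le> R" for t
    proof -
      have "a t \<le> 0" "b t \<le> 0" using that S by (auto simp: a_def b_def divide_nonpos_pos)
      then show "f t = 1" "f' t = 0" by (auto simp: f_def f'_def q)
    qed
    show "f t = 0" if "\<bar>t\<bar> \<ge> R + S" for t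
    proof -
      have "a t \<ge> 1 \<or> b t \<ge> 1" using that S by (auto simp: a_def b_def)
      then show "f t = 0" by (auto simp: f_def q)
    qed
  qed
qed

lemma content_symmetric_box:
  fixes A B :: real
  assumes "A \<ge> 0" "B \<ge> 0"
  shows "measure lborel (cbox (- A, - B) (A, B)) = 4 * A * B"
  using assms by (simp add: content_Pair)

context grushin_minimizer
begin

text \<open>
  The competitor equals \<open>\<alpha>\<close> on \<open>grushin_box R\<close> and \<open>u\<close> outside a layer of volume \<open>O(R\<^sup>2)\<close>,
  on which its Grushin gradient stays bounded.
\<close>

lemma energy_growth:
  assumes B: "\<And>p. norm (\<alpha> - u p) \<le> B"
    and Mx: "\<And>p. norm (ux p) \<le> M" and My: "\<And>p. \<bar>fst p\<bar> * norm (uy p) \<le> M"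
    and H0: "\<And>w. 0 \<le> H w" and H\<alpha>: "H \<alpha> = 0"
    and K: "\<And>p t. 0 \<le> t \<Longrightarrow> t \<le> 1 \<Longrightarrow> H (u p + t *\<^sub>R (\<alpha> - u p)) \<le> K"
  shows "\<exists>C. \<forall>R\<ge>1. integral (grushin_box R) grad_sq \<le> C * R\<^sup>2"
proof (intro exI allI impI)
  \<comment> \<open>\<open>D\<close> bounds the density of the competitor: 8 * B comes from
    |\<theta>x| \<le> 8, and 16 * B from |x| \<le> 2 R together with |\<theta>y| \<le> 8 /
    R.\<close>
  define D where "D = ((M + 8 * B)\<^sup>2 + (M + 16 * B)\<^sup>2) / 2 + K"
  have B0: "B \<ge> 0" using B[of undefined] norm_ge_zero order_trans by blast
  have M0: "M \<ge> 0" using Mx[of undefined] norm_ge_zero order_trans by blast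
  have K0: "K \<ge> 0" using K[of 0 undefined] H0[of "u undefined"] by simp
  have D0: "D \<ge> 0" using K0 by (simp add: D_def)
  fix R :: real assume R: "R \<ge> 1"
  then have R0: "R > 0" by simp
  obtain f f' where f: "\<And>t. (f has_real_derivative f' t) (at t)" "continuous_on UNIV f'"
    "\<And>t. 0 \<le> f t" "\<And>t. f t \<le> 1" "\<And>t. \<bar>f' t\<bar> \<le> 8 / 1"
    "\<And>t. \<bar>t\<bar> \<le> R \<Longrightarrow> f t = 1" "\<And>t. \<bar>t\<bar> \<le> R \<Longrightarrow> f' t = 0" "\<And>t. \<bar>t\<bar> \<ge> R + 1 \<Longrightarrow> f t = 0"
    by (rule plateau[OF zero_less_one, where R = R]) (rule that; assumption)
  \<comment> \<open>The layer has width 1 in x but R in y: the slope 8 / R compensates the weight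
    |x| in Y, and both parts of the layer still have volume O(R^2).\<close>
  obtain g g' where g: "\<And>t. (g has_real_derivative g' t) (at t)" "continuous_on UNIV g'"
    "\<And>t. 0 \<le> g t" "\<And>t. g t \<le> 1" "\<And>t. \<bar>g' t\<bar> \<le> 8 / R"
    "\<And>t. \<bar>t\<bar> \<le> R\<^sup>2 \<Longrightarrow> g t = 1" "\<And>t. \<bar>t\<bar> \<le> R\<^sup>2 \<Longrightarrow> g' t = 0" "\<And>t. \<bar>t\<bar> \<ge> R\<^sup>2 + R \<Longrightarrow> g t = 0"
    by (rule plateau[OF R0, where R = "R\<^sup>2"]) (rule that; assumption)
  define \<theta> where "\<theta> p = f (fst p) * g (snd p)" for p
  define \<theta>x where "\<theta>x p = f' (fst p) * g (snd p)" for p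
  define \<theta>y where "\<theta>y p = f (fst p) * g' (snd p)" for p
  have c1f: "has_C1_partials (\<lambda>p. f (fst p)) (\<lambda>p. f' (fst p)) (\<lambda>p. 0)"
    by (rule has_C1_partials_cong[OF has_C1_partials_compose[OF has_C1_partials_fst f(1)]])
       (auto intro!: continuous_intros continuous_on_compose2[OF f(2)])
  have c1g: "has_C1_partials (\<lambda>p. g (snd p)) (\<lambda>p. 0) (\<lambda>p. g' (snd p))"
    by (rule has_C1_partials_cong[OF has_C1_partials_compose[OF has_C1_partials_snd g(1)]])
       (auto intro!: continuous_intros continuous_on_compose2[OF g(2)])
  have \<theta>: "has_C1_partials \<theta> \<theta>x \<theta>y"
    unfolding \<theta>_def
    by (rule has_C1_partials_cong[OF has_C1_partials_mult[OF c1f c1g]]) (auto simp: \<theta>x_def \<theta>y_def)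
  have \<theta>01: "0 \<le> \<theta> p" "\<theta> p \<le> 1" for p by (auto simp: \<theta>_def f g mult_le_one)
  have \<theta>x: "\<bar>\<theta>x p\<bar> \<le> 8" for p
  proof -
    have "\<bar>f' (fst p)\<bar> * \<bar>g (snd p)\<bar> \<le> (8 / 1) * 1" by (intro mult_mono f) (auto simp: g)
    then show ?thesis by (simp add: \<theta>x_def abs_mult)
  qed
  have \<theta>y: "\<bar>\<theta>y p\<bar> \<le> 8 / R" for p
  proof -
    have "\<bar>f (fst p)\<bar> * \<bar>g' (snd p)\<bar> \<le> 1 * (8 / R)" by (intro mult_mono g) (auto simp: f)
    then show ?thesis by (simp add: \<theta>y_def abs_mult)
  qed
  define \<phi> where "\<phi> p = \<theta> p *\<^sub>R (\<alpha> - u p)" for p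
  define \<phi>x where "\<phi>x p = \<theta>x p *\<^sub>R (\<alpha> - u p) - \<theta> p *\<^sub>R ux p" for p
  define \<phi>y where "\<phi>y p = \<theta>y p *\<^sub>R (\<alpha> - u p) - \<theta> p *\<^sub>R uy p" for p
  have neg_u: "has_C1_partials (\<lambda>p. \<alpha> - u p) (\<lambda>p. - ux p) (\<lambda>p. - uy p)"
    by (rule has_C1_partialsI)
       (auto intro!: derivative_eq_intros has_C1_partials_derivative[OF u] continuous_intros cont_u)
  have \<phi>: "has_C1_partials \<phi> \<phi>x \<phi>y"
    unfolding \<phi>_def
    by (rule has_C1_partials_cong[OF has_C1_partials_scaleR[OF \<theta> neg_u]]) (auto simp: \<phi>x_def \<phi>y_def)
  define Q where "Q = cbox (- (R + 1), - (R\<^sup>2 + R)) (R + 1, R\<^sup>2 + R)"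
  have sub: "grushin_box R \<subseteq> Q"
    using R by (auto simp: grushin_box_def Q_def)
  let ?u = "grushin_density H u ux uy"
  let ?v = "grushin_density H (\<lambda>p. u p + \<phi> p) (\<lambda>p. ux p + \<phi>x p) (\<lambda>p. uy p + \<phi>y p)"
  have cont_dens: "continuous_on S ?u" "continuous_on S ?v" for S
    unfolding grushin_density_def
    by (intro continuous_intros cont_u has_C1_partials_continuous[OF \<phi>] continuous_on_compose2[OF cont_H]; simp)+
  have v_in: "?v p = 0" if "p \<in> grushin_box R" for p
  proof -
    have p: "\<bar>fst p\<bar> \<le> R" "\<bar>snd p\<bar> \<le> R\<^sup>2"
      using that by (cases p; auto simp: grushin_box_def abs_le_iff)+
    then have "\<theta> p = 1" "\<theta>x p = 0" "\<theta>y p = 0"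
      by (simp_all add: \<theta>_def \<theta>x_def \<theta>y_def f g)
    then show ?thesis by (simp add: grushin_density_def \<phi>_def \<phi>x_def \<phi>y_def H\<alpha>)
  qed
  have v_le: "?v p \<le> D" if "p \<in> Q" for p
  proof -
    have x: "\<bar>fst p\<bar> \<le> 2 * R" using that R by (cases p) (auto simp: Q_def)
    have "ux p + \<phi>x p = (1 - \<theta> p) *\<^sub>R ux p + \<theta>x p *\<^sub>R (\<alpha> - u p)"
      by (simp add: \<phi>x_def algebra_simps)
    also have "norm \<dots> \<le> \<bar>1 - \<theta> p\<bar> * norm (ux p) + \<bar>\<theta>x p\<bar> * norm (\<alpha> - u p)"
      by (rule norm_triangle_le) simp
    also have "\<dots> \<le> 1 * M + 8 * B"
      by (intro add_mono mult_mono Mx B \<theta>x) (use \<theta>01[of p] M0 in auto)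
    finally have 1: "(norm (ux p + \<phi>x p))\<^sup>2 \<le> (M + 8 * B)\<^sup>2" by (intro power_mono) auto
    have "uy p + \<phi>y p = (1 - \<theta> p) *\<^sub>R uy p + \<theta>y p *\<^sub>R (\<alpha> - u p)"
      by (simp add: \<phi>y_def algebra_simps)
    also have "norm \<dots> \<le> \<bar>1 - \<theta> p\<bar> * norm (uy p) + \<bar>\<theta>y p\<bar> * norm (\<alpha> - u p)"
      by (rule norm_triangle_le) simp
    finally have "\<bar>fst p\<bar> * norm (uy p + \<phi>y p) \<le>
        \<bar>fst p\<bar> * (\<bar>1 - \<theta> p\<bar> * norm (uy p) + \<bar>\<theta>y p\<bar> * norm (\<alpha> - u p))"
      by (rule mult_left_mono) simp
    also have "\<dots> = \<bar>1 - \<theta> p\<bar> * (\<bar>fst p\<bar> * norm (uy p)) + (\<bar>fst p\<bar> * \<bar>\<theta>y p\<bar>) * norm (\<alpha> - u p)"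
      by (simp add: algebra_simps)
    also have "\<dots> \<le> 1 * M + (2 * R * (8 / R)) * B"
      by (intro add_mono mult_mono My B \<theta>y x) (use \<theta>01[of p] M0 R in auto)
    also have "\<dots> = M + 16 * B" using R by simp
    finally have "(\<bar>fst p\<bar> * norm (uy p + \<phi>y p))\<^sup>2 \<le> (M + 16 * B)\<^sup>2" by (intro power_mono) auto
    then have 2: "(fst p)\<^sup>2 * (norm (uy p + \<phi>y p))\<^sup>2 \<le> (M + 16 * B)\<^sup>2" by (simp add: power_mult_distrib)
    have "H (u p + \<phi> p) \<le> K" unfolding \<phi>_def by (rule K[OF \<theta>01])
    then show ?thesis using 1 2 unfolding grushin_density_def D_def by argo
  qed
  have int: "?u integrable_on Q" "?v integrable_on Q" "?u integrable_on grushin_box R"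
      "grad_sq integrable_on grushin_box R"
    unfolding Q_def grushin_box_def by (intro integrable_continuous cont_dens cont_grad_sq)+
  have intc: "(\<lambda>p. c) integrable_on grushin_box R" "(\<lambda>p. c) integrable_on Q" for c :: real
    unfolding Q_def grushin_box_def by (intro integrable_continuous continuous_intros)+
  have ind: "(\<lambda>p. if p \<in> grushin_box R then D else 0) integrable_on Q"
    using intc(1)[of D] sub integrable_restrict_Int[of "grushin_box R" "\<lambda>_. D" Q] by (simp add: Int_absorb2)
  have "integral (grushin_box R) (\<lambda>p. 1 / 2 * grad_sq p) \<le> integral (grushin_box R) ?u"
    by (rule integral_le[OF integrable_on_mult_right[OF int(4)] int(3)])
       (use H0 in \<open>auto simp: grad_sq_def grushin_density_def power2_norm_eq_inner\<close>)
  also have "\<dots> \<le> integral Q ?u"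
    by (rule integral_subset_le[OF sub int(3,1)]) (auto simp: grushin_density_def H0)
  also have "\<dots> \<le> integral Q ?v"
    unfolding Q_def
  proof (rule minimal[OF \<phi>])
    fix p assume "p \<notin> box (- (R + 1), - (R\<^sup>2 + R)) (R + 1, R\<^sup>2 + R)"
    then have "\<bar>fst p\<bar> \<ge> R + 1 \<or> \<bar>snd p\<bar> \<ge> R\<^sup>2 + R"
      by (cases p) (auto simp: mem_box Basis_prod_def abs_le_iff)
    then show "\<phi> p = 0" by (auto simp: \<phi>_def \<theta>_def f g)
  qed
  also have "\<dots> \<le> integral Q (\<lambda>p. D - (if p \<in> grushin_box R then D else 0))"
    by (rule integral_le[OF int(2) integrable_diff[OF intc(2) ind]]) (auto simp: v_in v_le)
  also have "\<dots> = integral Q (\<lambda>p. D) - integral (grushin_box R) (\<lambda>p. D)"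
    using integral_diff[OF intc(2) ind, of D] sub integral_restrict_Int[of Q "grushin_box R" "\<lambda>_. D"]
    by (simp add: Int_absorb2)
  also have "\<dots> = 4 * (R + 1) * (R\<^sup>2 + R) * D - 4 * R * R\<^sup>2 * D"
    unfolding Q_def grushin_box_def using R
    by (simp add: content_symmetric_box del: neg_equal_iff_equal minus_add_distrib)
  also have "\<dots> = (8 * R\<^sup>2 + 4 * R) * D" by (simp add: power2_eq_square algebra_simps)
  \<comment> \<open>Since R \<ge> 1, R is absorbed into R^2; the final 24 undoes the factor 1/2 in
    the density.\<close>
  also have "\<dots> \<le> (12 * R\<^sup>2) * D"
    using R D0 by (intro mult_right_mono) (auto simp: power2_eq_square)
  finally show "integral (grushin_box R) grad_sq \<le> (24 * D) * R\<^sup>2" by (simp add: mult_ac)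
qed

end

section \<open>One-dimensional symmetry\<close>

lemma C2_on_imp_partials:
  fixes f :: "real \<times> real \<Rightarrow> 'b::euclidean_space"
  assumes "C2_on UNIV f"
  obtains fx fy fxx fxy fyy where "has_C1_partials f fx fy" "has_C1_partials fx fxx fxy" "has_C1_partials fy fxy fyy"
proof -
  obtain f' :: "real \<times> real \<Rightarrow> (real \<times> real) \<Rightarrow>\<^sub>L 'b"
    and f'' :: "real \<times> real \<Rightarrow> (real \<times> real) \<Rightarrow>\<^sub>L (real \<times> real) \<Rightarrow>\<^sub>L 'b"
    where f': "\<And>p. (f has_derivative f' p) (at p)" and f'': "\<And>p. (f' has_derivative f'' p) (at p)"
      and cont: "continuous_on UNIV f''"
    using assms unfolding C2_on_def C1_on_def by blast
  have cont': "continuous_on UNIV f'"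
    by (meson f'' has_derivative_continuous continuous_at_imp_continuous_on)
  have split: "blinfun_apply L h = fst h *\<^sub>R L (1, 0) + snd h *\<^sub>R L (0, 1)"
    for L :: "(real \<times> real) \<Rightarrow>\<^sub>L 'c::real_normed_vector" and h
  proof -
    have "h = fst h *\<^sub>R (1, 0) + snd h *\<^sub>R (0, 1)" by (simp add: prod_eq_iff)
    then show ?thesis by (metis blinfun.add_right blinfun.scaleR_right)
  qed
  have 1: "has_C1_partials f (\<lambda>p. f' p (1, 0)) (\<lambda>p. f' p (0, 1))"
    by (rule has_C1_partialsI)
       (auto intro!: continuous_intros cont' has_derivative_eq_rhs[OF f'] ext split)
  have 2: "has_C1_partials (\<lambda>p. f' p k) (\<lambda>p. f'' p (1, 0) k) (\<lambda>p. f'' p (0, 1) k)" for k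
  proof (rule has_C1_partialsI)
    show "((\<lambda>p. f' p k) has_derivative (\<lambda>h. fst h *\<^sub>R f'' p (1, 0) k + snd h *\<^sub>R f'' p (0, 1) k)) (at p)" for p
    proof (rule has_derivative_eq_rhs)
      show "((\<lambda>p. f' p k) has_derivative (\<lambda>h. f'' p h k)) (at p)"
        by (rule bounded_linear.has_derivative[OF
              bounded_bilinear.bounded_linear_left[OF bounded_bilinear_blinfun_apply] f''])
      show "(\<lambda>h. f'' p h k) = (\<lambda>h. fst h *\<^sub>R f'' p (1, 0) k + snd h *\<^sub>R f'' p (0, 1) k)"
        by (rule ext, subst split) (simp add: blinfun.add_left blinfun.scaleR_left)
    qed
  qed (intro continuous_intros cont)+
  \<comment> \<open>Symmetry of the second derivative is what allows a single \<open>fxy\<close> in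
    both expansions.\<close>
  have "f'' p (0, 1) (1, 0) = f'' p (1, 0) (0, 1)" for p
    by (rule mixed_partials[OF 1 2 2])
  with 1 2[of "(1, 0)"] 2[of "(0, 1)"] show thesis
    by (intro that[of "\<lambda>p. f' p (1, 0)" "\<lambda>p. f' p (0, 1)" "\<lambda>p. f'' p (1, 0) (1, 0)"
          "\<lambda>p. f'' p (1, 0) (0, 1)" "\<lambda>p. f'' p (0, 1) (0, 1)"]) simp_all
qed

text \<open>Makes u + \<phi> an admissible competitor in \<open>local_minimum\<close>. The partials
  are bounded on a compact ball around each point.\<close>

lemma has_C1_partials_locally_lipschitz:
  assumes f: "has_C1_partials f fx fy"
  shows "locally_lipschitz_on UNIV f"
  unfolding locally_lipschitz_on_def
proof
  fix p :: "real \<times> real"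
  define g where "g q = norm (fx q) + norm (fy q)" for q
  have "continuous_on (cball p 1) g"
    unfolding g_def by (intro continuous_intros has_C1_partials_continuous[OF f])
  then have "bounded (g ` cball p 1)"
    using compact_continuous_image compact_cball compact_imp_bounded by blast
  then obtain L where L: "\<And>q. q \<in> cball p 1 \<Longrightarrow> norm (g q) \<le> L" "L > 0"
    unfolding bounded_pos by (metis imageI)
  have "L-lipschitz_on (ball p 1) f"
  proof (rule bounded_derivative_imp_lipschitz)
    show "(f has_derivative (\<lambda>h. fst h *\<^sub>R fx q + snd h *\<^sub>R fy q)) (at q within ball p 1)" for q
      by (rule has_derivative_at_withinI[OF has_C1_partials_derivative[OF f]])
    show "onorm (\<lambda>h. fst h *\<^sub>R fx q + snd h *\<^sub>R fy q) \<le> L" if q: "q \<in> ball p 1" for q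
    proof (rule onorm_le)
      fix h :: "real \<times> real"
      have "norm (fst h *\<^sub>R fx q + snd h *\<^sub>R fy q) \<le> norm (fst h) * norm (fx q) + norm (snd h) * norm (fy q)"
        by (rule norm_triangle_le) simp
      also have "\<dots> \<le> norm h * norm (fx q) + norm h * norm (fy q)"
        using norm_fst_le[of "fst h" "snd h"] norm_snd_le[of "snd h" "fst h"]
        by (intro add_mono mult_right_mono) simp_all
      also have "\<dots> = g q * norm h" by (simp add: g_def algebra_simps)
      also have "\<dots> \<le> L * norm h"
        using L(1)[of q] q by (intro mult_right_mono) auto
      finally show "norm (fst h *\<^sub>R fx q + snd h *\<^sub>R fy q) \<le> L * norm h" .
    qed
  qed (use L in auto)
  then show "\<exists>e>0. \<exists>L. L-lipschitz_on (ball p e \<inter> UNIV) f" by (metis Int_UNIV_right zero_less_one)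
qed

text \<open>The set where the bound fails is open and null, hence empty. This turns the L^infinity
  hypothesis into bounds at every point.\<close>

lemma AE_bound_imp_bound:
  fixes f :: "'a::euclidean_space \<Rightarrow> real"
  assumes "continuous_on UNIV f" and "AE p in lebesgue. \<bar>f p\<bar> \<le> C"
  shows "\<bar>f p\<bar> \<le> C"
proof -
  define S where "S = {p. C < \<bar>f p\<bar>}"
  have "open S"
    unfolding S_def by (intro open_Collect_less continuous_intros assms)
  moreover have "negligible S"
  proof -
    obtain N where "{p \<in> space lebesgue. \<not> \<bar>f p\<bar> \<le> C} \<subseteq> N" "N \<in> null_sets lebesgue"
      using assms(2) unfolding eventually_ae_filter by blast
    then show ?thesis
      by (intro negligible_subset[of N S]) (auto simp: negligible_iff_null_sets S_def)
  qed
  ultimately have "S = {}" using open_not_negligible by blast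
  then show ?thesis by (auto simp: S_def not_less)
qed

lemma has_C1_partials_component:
  fixes f :: "real \<times> real \<Rightarrow> real^'m::finite"
  assumes "has_C1_partials f fx fy"
  shows "has_C1_partials (\<lambda>p. f p $ i) (\<lambda>p. fx p $ i) (\<lambda>p. fy p $ i)"
  using has_C1_partials_inner_const[OF assms, of "axis i 1"] by (simp add: inner_axis)

lemma grushin_derivatives:
  assumes "has_C1_partials f fx fy"
  shows "grushin_X f = fx" "grushin_Y f = (\<lambda>p. fst p * fy p)" "grushin_Z f = fy"
    "(grushin_grad_norm f p)\<^sup>2 = (fx p)\<^sup>2 + (fst p * fy p)\<^sup>2"
  by (auto simp: fun_eq_iff grushin_X_def grushin_Y_def grushin_Z_def grushin_grad_norm_def partial_eq[OF assms])

text \<open>Links the nonnegative Lebesgue integral of the energy over an open box to the integral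
  over the closed box used for the variations; the boundary is negligible.\<close>

lemma grushin_energy_box:
  fixes v :: "real \<times> real \<Rightarrow> real^'m::finite"
  assumes v: "has_C1_partials v vx vy" and H: "continuous_on UNIV H" "\<And>w. 0 \<le> H w"
  shows "grushin_energy H v (box a b) = ennreal (integral (cbox a b) (grushin_density H v vx vy))"
proof -
  let ?d = "grushin_density H v vx vy"
  have d: "1/2 * (\<Sum>i\<in>UNIV. (grushin_grad_norm (\<lambda>q. v q $ i) p)\<^sup>2) + H (v p) = ?d p" for p
    unfolding grushin_derivatives(4)[OF has_C1_partials_component[OF v]] grushin_density_def
    by (simp add: power2_norm_eq_inner inner_vec_def sum.distrib power_mult_distrib sum_distrib_left
        flip: power2_eq_square)
  have "continuous_on (cbox a b) ?d"
    unfolding grushin_density_def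
    by (intro continuous_intros has_C1_partials_continuous[OF v] continuous_on_compose2[OF H(1)]) auto
  then have "(?d has_integral integral (cbox a b) ?d) (box a b)"
    unfolding has_integral_open_interval by (intro integrable_integral integrable_continuous)
  moreover have "0 \<le> ?d p" for p by (simp add: grushin_density_def H)
  ultimately show ?thesis
    unfolding grushin_energy_def d
    by (simp add: nn_integral_completion nn_integral_has_integral_lebesgue')
qed

theorem theorem4p5:
  fixes H :: "real^'m::finite \<Rightarrow> real"
    and \<alpha> \<beta> :: "real^'m"
    and u :: "real \<times> real \<Rightarrow> real^'m"
  assumes "C2_on UNIV H"
    and "H \<alpha> = 0" and "H \<beta> = 0" and "\<And>w. 0 \<le> H w"
    and "C2_on UNIV u"
    and "local_minimum H UNIV u"
    and "\<And>i p. \<alpha> $ i \<le> u p $ i \<and> u p $ i \<le> \<beta> $ i"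
    and "\<And>i. L_infinity (grushin_grad_norm (\<lambda>q. u q $ i))"
    and "\<And>i p. grushin_grad_norm (\<lambda>q. u q $ i) p \<noteq> 0"
    and "\<And>i p. grushin_Z (grushin_Y (\<lambda>q. u q $ i)) p * grushin_X (\<lambda>q. u q $ i) p
               - grushin_Z (grushin_X (\<lambda>q. u q $ i)) p * grushin_Y (\<lambda>q. u q $ i) p \<le> 0"
  shows "\<forall>i. \<exists>g :: real \<Rightarrow> real. \<forall>x y. u (x, y) $ i = g x"
proof
  fix i
  obtain ux uy uxx uxy uyy where u: "has_C1_partials u ux uy" and ux: "has_C1_partials ux uxx uxy"
    and uy: "has_C1_partials uy uxy uyy"
    using C2_on_imp_partials[OF assms(5)] .
  obtain dH :: "real^'m \<Rightarrow> (real^'m) \<Rightarrow>\<^sub>L real" and d2H :: "real^'m \<Rightarrow> (real^'m) \<Rightarrow>\<^sub>L (real^'m) \<Rightarrow>\<^sub>L real"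
    where dH: "\<And>w. (H has_derivative dH w) (at w)" and d2H: "\<And>w. (dH has_derivative d2H w) (at w)"
      and cont_d2H: "continuous_on UNIV d2H"
    using assms(1) unfolding C2_on_def C1_on_def by blast
  have cont_H: "continuous_on UNIV H"
    by (meson dH has_derivative_continuous continuous_at_imp_continuous_on)
  interpret grushin_minimizer H dH d2H u ux uy uxx uxy uyy
  proof
    fix \<phi> \<phi>x \<phi>y :: "real \<times> real \<Rightarrow> real^'m" and a b
    assume \<phi>: "has_C1_partials \<phi> \<phi>x \<phi>y" and supp: "\<And>p. p \<notin> box a b \<Longrightarrow> \<phi> p = 0"
    note v = has_C1_partials_add[OF u \<phi>]
    have "grushin_energy H u (box a b) \<le> grushin_energy H (\<lambda>p. u p + \<phi> p) (box a b)"
      using assms(6) has_C1_partials_locally_lipschitz[OF v] supp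
      unfolding local_minimum_def by (simp add: open_box bounded_box)
    then have "ennreal (integral (cbox a b) (grushin_density H u ux uy)) \<le>
        ennreal (integral (cbox a b) (grushin_density H (\<lambda>p. u p + \<phi> p) (\<lambda>p. ux p + \<phi>x p) (\<lambda>p. uy p + \<phi>y p)))"
      unfolding grushin_energy_box[OF u cont_H assms(4)] grushin_energy_box[OF v cont_H assms(4)] .
    \<comment> \<open>\<open>ennreal\<close> sends negative reals to 0, so the inequality passes
      back to real numbers only once the right side is known to be nonnegative.\<close>
    moreover have "0 \<le> integral (cbox a b) (grushin_density H (\<lambda>p. u p + \<phi> p) (\<lambda>p. ux p + \<phi>x p) (\<lambda>p. uy p + \<phi>y p))"
      by (rule integral_nonneg)
         (auto simp: grushin_density_def assms(4) intro!: integrable_continuous continuous_intros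
           has_C1_partials_continuous[OF u] has_C1_partials_continuous[OF \<phi>] continuous_on_compose2[OF cont_H])
    ultimately show "integral (cbox a b) (grushin_density H u ux uy) \<le>
        integral (cbox a b) (grushin_density H (\<lambda>p. u p + \<phi> p) (\<lambda>p. ux p + \<phi>x p) (\<lambda>p. uy p + \<phi>y p))"
      by simp
  qed (fact dH d2H cont_d2H u ux uy)+
  note grad = grushin_derivatives(4)[OF has_C1_partials_component[OF u]]
  have "\<exists>C. \<forall>p. \<bar>ux p $ j\<bar> \<le> C \<and> \<bar>fst p * uy p $ j\<bar> \<le> C" for j
  proof -
    have eq: "grushin_grad_norm (\<lambda>q. u q $ j) = (\<lambda>p. sqrt ((ux p $ j)\<^sup>2 + (fst p * uy p $ j)\<^sup>2))"
      by (simp add: fun_eq_iff grushin_grad_norm_def grushin_derivatives[OF has_C1_partials_component[OF u]])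
    have "continuous_on UNIV (\<lambda>p. sqrt ((ux p $ j)\<^sup>2 + (fst p * uy p $ j)\<^sup>2))"
      by (intro continuous_intros cont_u)
    moreover obtain C where "AE p in lebesgue. \<bar>sqrt ((ux p $ j)\<^sup>2 + (fst p * uy p $ j)\<^sup>2)\<bar> \<le> C"
      using assms(8)[of j] unfolding L_infinity_def eq by blast
    ultimately have C: "\<bar>sqrt ((ux p $ j)\<^sup>2 + (fst p * uy p $ j)\<^sup>2)\<bar> \<le> C" for p
      by (rule AE_bound_imp_bound)
    have "\<bar>a\<bar> \<le> \<bar>sqrt (a\<^sup>2 + b\<^sup>2)\<bar>" "\<bar>b\<bar> \<le> \<bar>sqrt (a\<^sup>2 + b\<^sup>2)\<bar>" for a b :: real
      by (simp_all add: real_le_rsqrt)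
    then show ?thesis using C order_trans by blast
  qed
  then obtain C where C: "\<And>j p. \<bar>ux p $ j\<bar> \<le> C j" "\<And>j p. \<bar>fst p * uy p $ j\<bar> \<le> C j"
    by metis
  have curv: "curvature p = (\<Sum>j\<in>UNIV. fst p * (uyy p $ j * ux p $ j - uxy p $ j * uy p $ j))" for p
    by (simp add: curvature_def inner_vec_def sum_distrib_left sum_subtractf right_diff_distrib)
  have curv_le: "fst p * (uyy p $ j * ux p $ j - uxy p $ j * uy p $ j) \<le> 0" for p j
  proof -
    have "grushin_Z (\<lambda>p. fst p * uy p $ j) = (\<lambda>p. fst p * uyy p $ j)"
      using grushin_derivatives(3)[OF has_C1_partials_mult[OF has_C1_partials_fst has_C1_partials_component[OF uy]]]
      by simp
    then show ?thesis
      using assms(10)[of j p]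
      by (simp add: grushin_derivatives[OF has_C1_partials_component[OF u]]
          grushin_derivatives(3)[OF has_C1_partials_component[OF ux]] algebra_simps)
  qed
  have curv_nonpos: "curvature p \<le> 0" for p
    unfolding curv by (intro sum_nonpos curv_le)
  \<comment> \<open>The bounds on u force \<alpha> \<le> \<beta> componentwise, so this compact
    convex box contains every segment from a value of u to \<alpha>. The bound \<open>K\<close> for
    the potential along the competitor comes from here.\<close>
  have box: "u p \<in> cbox \<alpha> \<beta>" "\<alpha> \<in> cbox \<alpha> \<beta>" for p
    using assms(7) by (auto simp: mem_box_cart intro: order_trans)
  have "compact (H ` cbox \<alpha> \<beta>)"
    by (intro compact_continuous_image compact_cbox continuous_on_subset[OF cont_H]) simp
  then have "bdd_above (H ` cbox \<alpha> \<beta>)"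
    by (intro bounded_imp_bdd_above compact_imp_bounded)
  then obtain K where K: "\<And>w. w \<in> cbox \<alpha> \<beta> \<Longrightarrow> H w \<le> K"
    unfolding bdd_above_def by auto
  have "\<exists>C. \<forall>R\<ge>1. integral (grushin_box R) grad_sq \<le> C * R\<^sup>2"
  proof (rule energy_growth[where \<alpha> = \<alpha> and B = "norm (\<beta> - \<alpha>)" and M = "\<Sum>j\<in>UNIV. C j" and K = K])
    show "norm (\<alpha> - u p) \<le> norm (\<beta> - \<alpha>)" for p
      by (rule norm_le_componentwise_cart) (use assms(7) in \<open>simp add: abs_le_iff, smt\<close>)
    show "norm (ux p) \<le> (\<Sum>j\<in>UNIV. C j)" for p
      by (rule order_trans[OF norm_le_l1_cart]) (intro sum_mono C)
    show "\<bar>fst p\<bar> * norm (uy p) \<le> (\<Sum>j\<in>UNIV. C j)" for p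
    proof -
      have "\<bar>fst p\<bar> * norm (uy p) = norm (fst p *\<^sub>R uy p)" by simp
      also have "\<dots> \<le> (\<Sum>j\<in>UNIV. \<bar>(fst p *\<^sub>R uy p) $ j\<bar>)" by (rule norm_le_l1_cart)
      also have "\<dots> \<le> (\<Sum>j\<in>UNIV. C j)" using C(2) by (intro sum_mono) simp
      finally show ?thesis .
    qed
    show "H (u p + t *\<^sub>R (\<alpha> - u p)) \<le> K" if "0 \<le> t" "t \<le> 1" for p t
    proof (rule K)
      have "(1 - t) *\<^sub>R u p + t *\<^sub>R \<alpha> \<in> cbox \<alpha> \<beta>"
        using box that by (intro convexD[OF convex_box(1)]) auto
      then show "u p + t *\<^sub>R (\<alpha> - u p) \<in> cbox \<alpha> \<beta>" by (simp add: algebra_simps)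
    qed
  qed (use assms in auto)
  then obtain A where A: "\<And>R. R \<ge> 1 \<Longrightarrow> integral (grushin_box R) grad_sq \<le> A * R\<^sup>2" by blast
  have "- curvature p = 0" for p
  proof (rule weighted_poincare_liouville[where W = grad_sq and \<kappa> = "\<lambda>p. - curvature p", OF _ _ _ _ A])
    show "grad_sq p \<ge> 0" for p by (simp add: grad_sq_def)
    show "continuous_on UNIV (\<lambda>p. - curvature p)" by (intro continuous_intros cont_curvature)
    show "- curvature p \<ge> 0" for p using curv_nonpos by simp
  qed (rule cont_grad_sq, assumption, (rule weighted_poincare; assumption))
  \<comment> \<open>A vanishing sum of nonpositive terms has only vanishing terms.\<close>
  then have "fst p * (uyy p $ i * ux p $ i - uxy p $ i * uy p $ i) = 0" for p
    using sum_nonneg_eq_0_iff[of UNIV "\<lambda>j. - (fst p * (uyy p $ j * ux p $ j - uxy p $ j * uy p $ j))"]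
      curv_le[of p] curv[of p] by (auto simp: sum_negf)
  then interpret component: parallel_gradient "\<lambda>p. u p $ i" "\<lambda>p. ux p $ i" "\<lambda>p. uy p $ i"
    "\<lambda>p. uxx p $ i" "\<lambda>p. uxy p $ i" "\<lambda>p. uyy p $ i"
  proof unfold_locales
    show "ux p $ i \<noteq> 0 \<or> fst p * uy p $ i \<noteq> 0" for p
      using assms(9)[of i p] grad[of i p] by fastforce
  qed (intro has_C1_partials_component u ux uy)+
  show "\<exists>g. \<forall>x y. u (x, y) $ i = g x"
    by (rule component.independent_of_y[OF C])
qed

end
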